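(* Let $\mathbb{H}$ and $\mathbb{K}$ be complex Hilbert spaces, and let $A$ be a bounded linear operator on $\mathbb{H}$ and $B$ a bounded linear operator on $\mathbb{K}$. Then $$w^2(A \otimes B) \leq \frac{1}{4} \left\| |A|^2 \otimes |B|^2+|A^*|^2 \otimes |B^*|^2\right\|+\frac{1}{2}\left\| \Re\big(|A||A^*| \otimes |B||B^*|\big)\right\|$$ $$\leq \frac{1}{4}\left(\|A\|\|B\|+\|A^2\|^{1/2}\|B^2\|^{1/2}\right)^2 \leq \|A\|^2\|B\|^2.$$
   Context: For a bounded linear operator $T$ on a complex Hilbert space with inner product $\langle\cdot,\cdot\rangle$: the numerical radius is $w(T)=\sup\{|\langle Tx,x\rangle| : \|x\|=1\}$, and $w^2(T)$ denotes $(w(T))^2$; $\|T\|$ is the operator norm; $|T|=(T^*T)^{1/2}$; $\Re(T)=\frac{T+T^*}{2}$. $\mathbb{H}\otimes\mathbb{K}$ is the Hilbert space tensor product (the completion of the algebraic tensor product under the inner product determined by $\langle x\otimes y,z\otimes u\rangle=\langle x,z\rangle\langle y,u\rangle$), and $A\otimes B$ is the bounded linear operator on $\mathbb{H}\otimes\mathbb{K}$ determined by $(A\otimes B)(x\otimes y)=Ax\otimes By$. *)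

theory Defs
  imports "HOL-Analysis.Analysis" "HOL-Library.Multiset"
begin

section \<open>Complex inner product spaces and Hilbert spaces\<close>

text \<open>
  A complex inner product space is presented as a real one whose real inner product is the real
  part of a complex sesquilinear form, so that the norm, the metric and the topology are those of
  the library.  The complex inner product is linear in its first argument.
\<close>

class complex_inner = real_inner +
  fixes scaleC :: "complex \<Rightarrow> 'a \<Rightarrow> 'a"  (infixr "*\<^sub>C" 75)
    and cinner :: "'a \<Rightarrow> 'a \<Rightarrow> complex"
  assumes scaleC_add_right: "a *\<^sub>C (x + y) = a *\<^sub>C x + a *\<^sub>C y"
    and scaleC_add_left: "(a + b) *\<^sub>C x = a *\<^sub>C x + b *\<^sub>C x"
    and scaleC_scaleC: "a *\<^sub>C b *\<^sub>C x = (a * b) *\<^sub>C x"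
    and scaleR_eq_scaleC: "r *\<^sub>R x = complex_of_real r *\<^sub>C x"
    and cinner_add_left: "cinner (x + y) z = cinner x z + cinner y z"
    and cinner_scaleC_left: "cinner (a *\<^sub>C x) y = a * cinner x y"
    and cinner_commute: "cinner x y = cnj (cinner y x)"
    and inner_eq_Re_cinner: "inner x y = Re (cinner x y)"

class chilbert_space = complex_inner + complete_space

subclass (in chilbert_space) banach ..

lemma scaleC_one: "1 *\<^sub>C x = x"
  using scaleR_eq_scaleC[of 1 x] by simp

lemma scaleC_zero_left: "0 *\<^sub>C x = 0"
  using scaleR_eq_scaleC[of 0 x] by simp

lemma scaleC_zero_right: "a *\<^sub>C 0 = 0"
  using scaleC_add_right[of a 0 0] by simp

lemma scaleC_minus1: "(- 1) *\<^sub>C x = - x"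
  using scaleR_eq_scaleC[of "- 1" x] by simp

lemma cinner_add_right: "cinner x (y + z) = cinner x y + cinner x z"
  by (metis cinner_add_left cinner_commute complex_cnj_add)

lemma cinner_scaleC_right: "cinner x (a *\<^sub>C y) = cnj a * cinner x y"
  by (metis cinner_scaleC_left cinner_commute complex_cnj_mult)

lemma cinner_zero_left: "cinner 0 x = 0"
  using cinner_add_left[of 0 0 x] by simp

lemma cinner_zero_right: "cinner x 0 = 0"
  using cinner_add_right[of x 0 0] by simp

lemma cinner_minus_left: "cinner (- x) y = - cinner x y"
  using cinner_scaleC_left[of "- 1" x y] by (simp add: scaleC_minus1)

lemma cinner_diff_left: "cinner (x - y) z = cinner x z - cinner y z"
  using cinner_add_left[of x "- y" z] by (simp add: cinner_minus_left)

lemma cinner_self: "cinner x x = complex_of_real ((norm x)\<^sup>2)"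
proof (rule complex_eqI)
  show "Re (cinner x x) = Re (complex_of_real ((norm x)\<^sup>2))"
    by (simp add: power2_norm_eq_inner inner_eq_Re_cinner)
  have "Im (cinner x x) = Im (cnj (cinner x x))"
    using cinner_commute[of x x] by simp
  then show "Im (cinner x x) = Im (complex_of_real ((norm x)\<^sup>2))"
    by simp
qed

lemma cinner_eq_Complex: "cinner x y = Complex (inner x y) (inner x (\<i> *\<^sub>C y))"
  by (rule complex_eqI) (simp_all add: inner_eq_Re_cinner cinner_scaleC_right)

lemma norm_scaleC: "norm (a *\<^sub>C x) = cmod a * norm x"
proof -
  have "complex_of_real ((norm (a *\<^sub>C x))\<^sup>2) = (a * cnj a) * complex_of_real ((norm x)\<^sup>2)"
    unfolding cinner_self[symmetric] cinner_scaleC_left cinner_scaleC_right by (simp only: mult_ac)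
  also have "\<dots> = complex_of_real ((cmod a * norm x)\<^sup>2)"
    by (simp only: complex_norm_square[symmetric] of_real_mult[symmetric] power_mult_distrib
        of_real_power[symmetric])
  finally have "(norm (a *\<^sub>C x))\<^sup>2 = (cmod a * norm x)\<^sup>2"
    by (simp only: of_real_eq_iff)
  then show ?thesis
    by (rule power2_eq_imp_eq) simp_all
qed

lemma cmod_cinner_le: "cmod (cinner x y) \<le> norm x * norm y"
proof (cases "cinner x y = 0")
  case False
  define c where "c = cnj (cinner x y) / complex_of_real (cmod (cinner x y))"
  have c: "cmod c = 1"
    using False by (simp add: c_def norm_divide)
  have "cinner (c *\<^sub>C x) y = complex_of_real (cmod (cinner x y))"
    using False complex_norm_square[of "cinner x y"]
    by (simp add: c_def cinner_scaleC_left field_simps power2_eq_square)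
  then have "cmod (cinner x y) = inner (c *\<^sub>C x) y"
    by (simp add: inner_eq_Re_cinner)
  also have "\<dots> \<le> norm (c *\<^sub>C x) * norm y"
    by (rule norm_cauchy_schwarz)
  finally show ?thesis by (simp add: norm_scaleC c)
qed simp


section \<open>The algebraic tensor product\<close>

text \<open>
  A finite formal sum of elementary tensors is a multiset of pairs; the algebraic tensor product is
  the quotient of these sums by the congruence generated by bilinearity.
\<close>

inductive tens_eq ::
  "('a::complex_inner \<times> 'b::complex_inner) multiset \<Rightarrow> ('a \<times> 'b) multiset \<Rightarrow> bool" where
  refl: "tens_eq s s"
| sym: "tens_eq s t \<Longrightarrow> tens_eq t s"
| trans: "tens_eq s t \<Longrightarrow> tens_eq t u \<Longrightarrow> tens_eq s u"
| plus: "tens_eq s s' \<Longrightarrow> tens_eq t t' \<Longrightarrow> tens_eq (s + t) (s' + t')"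
| add_left: "tens_eq {#(x + x', y)#} {#(x, y), (x', y)#}"
| add_right: "tens_eq {#(x, y + y')#} {#(x, y), (x, y')#}"
| scale: "tens_eq {#(a *\<^sub>C x, y)#} {#(x, a *\<^sub>C y)#}"
| zero: "tens_eq {#(0, y)#} {#}"

definition tens_scale ::
  "complex \<Rightarrow> ('a::complex_inner \<times> 'b::complex_inner) multiset \<Rightarrow> ('a \<times> 'b) multiset" where
  "tens_scale a s = image_mset (\<lambda>p. (a *\<^sub>C fst p, snd p)) s"

definition tens_inner ::
  "('a::complex_inner \<times> 'b::complex_inner) multiset \<Rightarrow> ('a \<times> 'b) multiset \<Rightarrow> complex" where
  "tens_inner s t = (\<Sum>p\<in>#s. \<Sum>q\<in>#t. cinner (fst p) (fst q) * cinner (snd p) (snd q))"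

lemma tens_scale_simps [simp]:
  "tens_scale a {#} = {#}"
  "tens_scale a (add_mset p s) = add_mset (a *\<^sub>C fst p, snd p) (tens_scale a s)"
  "tens_scale a (s + t) = tens_scale a s + tens_scale a t"
  by (simp_all add: tens_scale_def)

lemma tens_inner_simps [simp]:
  "tens_inner {#} t = 0"
  "tens_inner (s + s') t = tens_inner s t + tens_inner s' t"
  by (simp_all add: tens_inner_def)

lemma tens_inner_add_mset:
  "tens_inner (add_mset p s) t = tens_inner {#p#} t + tens_inner s t"
  by (simp add: tens_inner_def)

lemma tens_inner_commute: "tens_inner s t = cnj (tens_inner t s)"
proof -
  have cnj_sum: "cnj (\<Sum>p\<in>#u. f p) = (\<Sum>p\<in>#u. cnj (f p))"
    for f :: "'c \<Rightarrow> complex" and u :: "'c multiset"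
    by (induction u) simp_all
  have "cnj (tens_inner t s) = (\<Sum>p\<in>#t. \<Sum>q\<in>#s. cinner (fst q) (fst p) * cinner (snd q) (snd p))"
    unfolding tens_inner_def cnj_sum complex_cnj_mult by (simp add: cinner_commute[symmetric])
  also have "\<dots> = tens_inner s t"
    unfolding tens_inner_def by (rule sum_mset.swap)
  finally show ?thesis by simp
qed

lemma tens_inner_cong_left: "tens_eq s s' \<Longrightarrow> tens_inner s t = tens_inner s' t"
  by (induction rule: tens_eq.induct)
    (simp_all add: tens_inner_def cinner_add_left cinner_scaleC_left cinner_zero_left
      distrib_left distrib_right sum_mset.distrib mult_ac)

lemma tens_inner_cong: "tens_eq s s' \<Longrightarrow> tens_eq t t' \<Longrightarrow> tens_inner s t = tens_inner s' t'"
  by (metis tens_inner_cong_left tens_inner_commute)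

lemma tens_inner_scale: "tens_inner (tens_scale a s) t = a * tens_inner s t"
  by (induction s)
    (simp_all add: tens_inner_add_mset[of _ _ t] distrib_left tens_inner_def cinner_scaleC_left
      sum_mset_distrib_left mult.assoc)

lemma tens_scale_cong: "tens_eq s s' \<Longrightarrow> tens_eq (tens_scale a s) (tens_scale a s')"
proof (induction rule: tens_eq.induct)
  case (add_left x x' y)
  show ?case using tens_eq.add_left[of "a *\<^sub>C x" "a *\<^sub>C x'" y] by (simp add: scaleC_add_right)
next
  case (scale b x y)
  show ?case using tens_eq.scale[of b "a *\<^sub>C x" y] by (simp add: scaleC_scaleC mult.commute)
next
  case (zero y)
  show ?case using tens_eq.zero[of y] by (simp add: scaleC_zero_right)
next
  case (trans s t u)
  then show ?case by (blast intro: tens_eq.trans)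
next
  case (sym s t)
  then show ?case by (blast intro: tens_eq.sym)
qed (simp_all add: tens_eq.refl tens_eq.plus tens_eq.add_right)

lemma tens_eq_add_mset:
  assumes "tens_eq {#p#} s'" "tens_eq t t'"
  shows "tens_eq (add_mset p t) (s' + t')"
  using tens_eq.plus[OF assms] by simp

lemma tens_scale_add: "tens_eq (tens_scale (a + b) s) (tens_scale a s + tens_scale b s)"
proof (induction s)
  case empty
  show ?case by (simp add: tens_eq.refl)
next
  case (add p s)
  have "tens_eq {#((a + b) *\<^sub>C fst p, snd p)#} {#(a *\<^sub>C fst p, snd p), (b *\<^sub>C fst p, snd p)#}"
    by (simp add: scaleC_add_left tens_eq.add_left)
  from tens_eq_add_mset[OF this add] show ?case
    by (simp add: add_mset_commute)
qed

lemma tens_scale_zero: "tens_eq (tens_scale 0 s) {#}"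
proof (induction s)
  case (add p s)
  have "tens_eq {#(0 *\<^sub>C fst p, snd p)#} {#}"
    by (simp add: scaleC_zero_left tens_eq.zero)
  from tens_eq_add_mset[OF this add] show ?case by simp
qed (simp add: tens_eq.refl)

lemma tens_scale_one: "tens_scale 1 s = s"
  by (simp add: tens_scale_def scaleC_one)

lemma tens_scale_scale: "tens_scale a (tens_scale b s) = tens_scale (a * b) s"
  by (simp add: tens_scale_def multiset.map_comp comp_def scaleC_scaleC)

text \<open>
  Positive definiteness: by Gram-Schmidt, every formal sum is congruent to one whose first
  components are nonzero and pairwise orthogonal.
\<close>

definition tens_orth :: "('a::complex_inner \<times> 'b::complex_inner) list \<Rightarrow> bool" where
  "tens_orth es \<longleftrightarrow> sorted_wrt (\<lambda>p q. cinner (fst p) (fst q) = 0) es \<and> (\<forall>p\<in>set es. fst p \<noteq> 0)"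

lemma tens_orthogonalize:
  assumes "tens_orth es"
  shows "\<exists>r es'. tens_eq (add_mset (x, y) (mset es)) (add_mset (r, y) (mset es'))
    \<and> map fst es' = map fst es \<and> (\<forall>e\<in>fst ` set es. cinner r e = 0)
    \<and> (\<forall>z. cinner x z = 0 \<longrightarrow> (\<forall>e\<in>fst ` set es. cinner e z = 0) \<longrightarrow> cinner r z = 0)"
  using assms
proof (induction es arbitrary: x)
  case Nil
  show ?case by (rule exI[of _ x], rule exI[of _ "[]"]) (simp add: tens_eq.refl)
next
  case (Cons p es)
  obtain e f where p: "p = (e, f)" by force
  have orth: "tens_orth es" and e: "e \<noteq> 0" and e_es: "\<forall>d\<in>fst ` set es. cinner e d = 0"
    using Cons.prems by (auto simp: tens_orth_def p)
  define c where "c = cinner x e / cinner e e"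
  define x' where "x' = x - c *\<^sub>C e"
  have ee: "cinner e e \<noteq> 0"
    using e by (simp add: cinner_self)
  obtain r es' where
    eq: "tens_eq (add_mset (x', y) (mset es)) (add_mset (r, y) (mset es'))"
    and fst: "map fst es' = map fst es"
    and r: "\<forall>d\<in>fst ` set es. cinner r d = 0"
    and z: "\<And>z. cinner x' z = 0 \<Longrightarrow> (\<forall>d\<in>fst ` set es. cinner d z = 0) \<Longrightarrow> cinner r z = 0"
    using Cons.IH[OF orth, of x'] by blast
  have "tens_eq {#(x' + c *\<^sub>C e, y)#} {#(x', y), (c *\<^sub>C e, y)#}"
    by (rule tens_eq.add_left)
  then have 1: "tens_eq {#(x, y)#} {#(x', y), (c *\<^sub>C e, y)#}"
    by (simp add: x'_def)
  have 2: "tens_eq ({#(c *\<^sub>C e, y)#} + {#(e, f)#}) {#(e, c *\<^sub>C y + f)#}"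
  proof (rule tens_eq.trans)
    show "tens_eq ({#(c *\<^sub>C e, y)#} + {#(e, f)#}) ({#(e, c *\<^sub>C y)#} + {#(e, f)#})"
      by (intro tens_eq.plus tens_eq.scale tens_eq.refl)
    show "tens_eq ({#(e, c *\<^sub>C y)#} + {#(e, f)#}) {#(e, c *\<^sub>C y + f)#}"
      using tens_eq.sym[OF tens_eq.add_right[of e "c *\<^sub>C y" f]] by (simp add: add_mset_commute)
  qed
  have 3: "tens_eq ({#(x, y)#} + ({#(e, f)#} + mset es))
      ({#(x', y), (c *\<^sub>C e, y)#} + ({#(e, f)#} + mset es))"
    by (intro tens_eq.plus 1 tens_eq.refl)
  have 4: "tens_eq (({#(c *\<^sub>C e, y)#} + {#(e, f)#}) + ({#(x', y)#} + mset es))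
      ({#(e, c *\<^sub>C y + f)#} + add_mset (r, y) (mset es'))"
    using eq by (intro tens_eq.plus 2) simp
  have "tens_eq (add_mset (x, y) (mset (p # es)))
      (add_mset (r, y) (mset ((e, c *\<^sub>C y + f) # es')))"
  proof -
    have a: "add_mset (x, y) (mset (p # es)) = {#(x, y)#} + ({#(e, f)#} + mset es)"
      by (simp add: p add_mset_commute)
    have b: "{#(x', y), (c *\<^sub>C e, y)#} + ({#(e, f)#} + mset es)
        = ({#(c *\<^sub>C e, y)#} + {#(e, f)#}) + ({#(x', y)#} + mset es)"
      by (simp add: add_mset_commute)
    have c: "add_mset (r, y) (mset ((e, c *\<^sub>C y + f) # es'))
        = {#(e, c *\<^sub>C y + f)#} + add_mset (r, y) (mset es')"
      by (simp add: add_mset_commute)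
    show ?thesis
      unfolding a c by (rule tens_eq.trans[OF 3]) (simp only: b 4)
  qed
  moreover have "map fst ((e, c *\<^sub>C y + f) # es') = map fst (p # es)"
    using fst by (simp add: p)
  moreover have "cinner r e = 0"
  proof (rule z)
    show "cinner x' e = 0"
      using ee by (simp add: x'_def c_def cinner_diff_left cinner_scaleC_left)
    show "\<forall>d\<in>fst ` set es. cinner d e = 0"
      using e_es by (metis cinner_commute complex_cnj_zero)
  qed
  moreover have "cinner r w = 0"
    if "cinner x w = 0" "\<forall>d\<in>fst ` set (p # es). cinner d w = 0" for w
    using that by (intro z) (auto simp: p x'_def cinner_diff_left cinner_scaleC_left)
  ultimately show ?case
    using r by (intro exI[of _ r] exI[of _ "(e, c *\<^sub>C y + f) # es'"]) (auto simp: p)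
qed

lemma tens_orth_map_fst:
  fixes es es' :: "('a::complex_inner \<times> 'b::complex_inner) list"
  assumes "map fst es = map fst es'"
  shows "tens_orth es = tens_orth es'"
proof -
  have "tens_orth es \<longleftrightarrow> sorted_wrt (\<lambda>x y. cinner x y = 0) (map fst es) \<and> 0 \<notin> set (map fst es)"
    for es :: "('a \<times> 'b) list"
    by (auto simp: tens_orth_def sorted_wrt_map image_iff)
  from this[of es] this[of es'] show ?thesis
    by (simp only: assms)
qed

lemma tens_eq_orth: "\<exists>es. tens_eq s (mset es) \<and> tens_orth es"
proof (induction s)
  case empty
  show ?case by (rule exI[of _ "[]"]) (simp add: tens_eq.refl tens_orth_def)
next
  case (add p s)
  obtain x y where p: "p = (x, y)" by force
  obtain es where es: "tens_eq s (mset es)" "tens_orth es"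
    using add by blast
  obtain r es' where
    eq: "tens_eq (add_mset (x, y) (mset es)) (add_mset (r, y) (mset es'))"
    and fst: "map fst es' = map fst es"
    and r: "\<forall>e\<in>fst ` set es. cinner r e = 0"
    using tens_orthogonalize[OF es(2), of x y] by blast
  have "tens_eq ({#p#} + s) ({#p#} + mset es)"
    by (intro tens_eq.plus es tens_eq.refl)
  then have eq': "tens_eq (add_mset p s) (add_mset (r, y) (mset es'))"
    using tens_eq.trans[of "add_mset p s" "add_mset (x, y) (mset es)"] eq by (simp add: p)
  have orth: "tens_orth es'"
    using es(2) fst tens_orth_map_fst by blast
  show ?case
  proof (cases "r = 0")
    case True
    have "tens_eq (add_mset (r, y) (mset es')) ({#} + mset es')"
      unfolding True by (intro tens_eq_add_mset tens_eq.zero tens_eq.refl)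
    then show ?thesis
      using tens_eq.trans[OF eq'] orth by auto
  next
    case False
    have "fst ` set es' = fst ` set es"
      using fst by (metis list.set_map)
    then have "\<forall>e\<in>fst ` set es'. cinner r e = 0"
      using r by simp
    then have "tens_orth ((r, y) # es')"
      using orth False by (simp add: tens_orth_def)
    then show ?thesis
      using eq' by (intro exI[of _ "(r, y) # es'"]) simp
  qed
qed

lemma tens_inner_orth:
  assumes "tens_orth es"
  shows "tens_inner (mset es) (mset es)
    = complex_of_real (\<Sum>p\<leftarrow>es. (norm (fst p))\<^sup>2 * (norm (snd p))\<^sup>2)"
  using assms
proof (induction es)
  case Nil
  show ?case by simp
next
  case (Cons p es)
  have 0: "\<forall>q\<in>set es. cinner (fst p) (fst q) = 0" and orth: "tens_orth es"
    using Cons.prems by (auto simp: tens_orth_def)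
  have pe: "tens_inner {#p#} (mset es) = 0"
    using 0 by (auto simp: tens_inner_def intro!: sum_mset.neutral)
  then have ep: "tens_inner (mset es) {#p#} = 0"
    using tens_inner_commute[of "mset es" "{#p#}"] by simp
  have pp: "tens_inner {#p#} {#p#} = complex_of_real ((norm (fst p))\<^sup>2 * (norm (snd p))\<^sup>2)"
    by (simp add: tens_inner_def cinner_self)
  have right: "tens_inner s (add_mset p (mset es)) = tens_inner s {#p#} + tens_inner s (mset es)" for s
    by (subst (1 2 3) tens_inner_commute) (simp add: tens_inner_add_mset[of p "mset es"])
  show ?case
    using Cons.IH[OF orth]
    by (simp add: tens_inner_add_mset[of p "mset es"] right pe ep pp)
qed

lemma tens_inner_self:
  fixes s :: "('a::complex_inner \<times> 'b::complex_inner) multiset"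
  shows "Re (tens_inner s s) \<ge> 0"
    and "Re (tens_inner s s) = 0 \<longleftrightarrow> tens_eq s {#}"
proof -
  obtain es where es: "tens_eq s (mset es)" "tens_orth es"
    using tens_eq_orth by blast
  let ?f = "\<lambda>p. (norm (fst p))\<^sup>2 * (norm (snd p))\<^sup>2"
  have eq: "Re (tens_inner s s) = (\<Sum>p\<leftarrow>es. ?f p)"
    using tens_inner_cong[OF es(1) es(1)] tens_inner_orth[OF es(2)] by simp
  show ge: "Re (tens_inner s s) \<ge> 0"
    unfolding eq by (rule sum_list_nonneg) auto
  have "tens_eq s {#}" if "Re (tens_inner s s) = 0"
  proof -
    have "\<forall>p\<in>set es. ?f p = 0"
      using that unfolding eq by (subst (asm) sum_list_nonneg_eq_0_iff) auto
    then have 0: "\<forall>p\<in>set es. snd p = 0"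
      using es(2) by (auto simp: tens_orth_def)
    have zero_right: "tens_eq {#(x, 0 :: 'b)#} {#}" for x :: 'a
    proof -
      have "tens_eq {#(0 *\<^sub>C x, 0)#} {#(x, 0 *\<^sub>C 0 :: 'b)#}"
        by (rule tens_eq.scale)
      then have "tens_eq {#(x, 0 :: 'b)#} {#(0, 0)#}"
        by (simp add: scaleC_zero_left tens_eq.sym)
      then show ?thesis
        by (rule tens_eq.trans) (rule tens_eq.zero)
    qed
    have "(\<forall>p\<in>set ds. snd p = 0) \<longrightarrow> tens_eq (mset ds) {#}" for ds :: "('a \<times> 'b) list"
    proof (induction ds)
      case Nil
      show ?case by (simp add: tens_eq.refl)
    next
      case (Cons p ds)
      have "tens_eq (add_mset p (mset ds)) ({#} + {#})"
        if p: "snd p = 0" and ds: "\<forall>q\<in>set ds. snd q = 0"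
      proof (rule tens_eq_add_mset)
        show "tens_eq {#p#} {#}"
          using zero_right[of "fst p"] p by (metis prod.collapse)
        show "tens_eq (mset ds) {#}"
          using Cons ds by blast
      qed
      then show ?case by simp
    qed
    then have "tens_eq (mset es) {#}"
      using 0 by blast
    with es(1) show ?thesis
      by (rule tens_eq.trans)
  qed
  moreover have "Re (tens_inner s s) = 0" if "tens_eq s {#}"
    using tens_inner_cong[OF that that] by simp
  ultimately show "Re (tens_inner s s) = 0 \<longleftrightarrow> tens_eq s {#}"
    by blast
qed

quotient_type (overloaded) ('a, 'b) alg_tensor =
  "('a::complex_inner \<times> 'b::complex_inner) multiset" / tens_eq
proof (rule equivpI)
  show "reflp tens_eq"
    by (rule reflpI) (rule tens_eq.refl)
  show "symp tens_eq"
    by (rule sympI) (rule tens_eq.sym)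
  show "transp tens_eq"
    by (rule transpI) (rule tens_eq.trans)
qed

lift_definition alg_tens :: "'a \<Rightarrow> 'b \<Rightarrow> ('a::complex_inner, 'b::complex_inner) alg_tensor"
  is "\<lambda>x y. {#(x, y)#}" .

instantiation alg_tensor :: (complex_inner, complex_inner) complex_inner
begin

lift_definition zero_alg_tensor :: "('a, 'b) alg_tensor" is "{#}" .

lift_definition plus_alg_tensor ::
  "('a, 'b) alg_tensor \<Rightarrow> ('a, 'b) alg_tensor \<Rightarrow> ('a, 'b) alg_tensor"
  is "(+)" by (rule tens_eq.plus)

lift_definition scaleC_alg_tensor ::
  "complex \<Rightarrow> ('a, 'b) alg_tensor \<Rightarrow> ('a, 'b) alg_tensor"
  is tens_scale by (rule tens_scale_cong)

lift_definition cinner_alg_tensor ::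
  "('a, 'b) alg_tensor \<Rightarrow> ('a, 'b) alg_tensor \<Rightarrow> complex"
  is tens_inner by (rule tens_inner_cong)

definition uminus_alg_tensor :: "('a, 'b) alg_tensor \<Rightarrow> ('a, 'b) alg_tensor" where
  "- x = (- 1) *\<^sub>C (x :: ('a, 'b) alg_tensor)"

definition minus_alg_tensor :: "('a, 'b) alg_tensor \<Rightarrow> ('a, 'b) alg_tensor \<Rightarrow> ('a, 'b) alg_tensor" where
  "x - y = x + - (y :: ('a, 'b) alg_tensor)"

definition scaleR_alg_tensor :: "real \<Rightarrow> ('a, 'b) alg_tensor \<Rightarrow> ('a, 'b) alg_tensor" where
  "r *\<^sub>R x = complex_of_real r *\<^sub>C (x :: ('a, 'b) alg_tensor)"

definition inner_alg_tensor :: "('a, 'b) alg_tensor \<Rightarrow> ('a, 'b) alg_tensor \<Rightarrow> real" where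
  "inner x y = Re (cinner x (y :: ('a, 'b) alg_tensor))"

definition norm_alg_tensor :: "('a, 'b) alg_tensor \<Rightarrow> real" where
  "norm x = sqrt (inner x (x :: ('a, 'b) alg_tensor))"

definition dist_alg_tensor :: "('a, 'b) alg_tensor \<Rightarrow> ('a, 'b) alg_tensor \<Rightarrow> real" where
  "dist x y = norm (x - y :: ('a, 'b) alg_tensor)"

definition sgn_alg_tensor :: "('a, 'b) alg_tensor \<Rightarrow> ('a, 'b) alg_tensor" where
  "sgn x = inverse (norm x) *\<^sub>R (x :: ('a, 'b) alg_tensor)"

definition uniformity_alg_tensor :: "(('a, 'b) alg_tensor \<times> ('a, 'b) alg_tensor) filter" where [code del]:
  "uniformity_alg_tensor = (INF e\<in>{0 <..}. principal {(x, y :: ('a, 'b) alg_tensor). dist x y < e})"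

definition open_alg_tensor :: "('a, 'b) alg_tensor set \<Rightarrow> bool" where [code del]:
  "open_alg_tensor U \<longleftrightarrow>
    (\<forall>x\<in>U. eventually (\<lambda>(x', y :: ('a, 'b) alg_tensor). x' = x \<longrightarrow> y \<in> U) uniformity)"

instance
proof
  fix x y z :: "('a, 'b) alg_tensor" and a b :: complex and r r' :: real
  show add_assoc: "x + y + z = x + (y + z)"
    by transfer (simp add: add.assoc tens_eq.refl)
  show "x + y = y + x"
    by transfer (simp add: add.commute tens_eq.refl)
  show zero_add: "0 + x = x"
    by transfer (simp add: tens_eq.refl)
  have scale_add: "(a + b) *\<^sub>C x = a *\<^sub>C x + b *\<^sub>C x" for a b and x :: "('a, 'b) alg_tensor"
    by transfer (rule tens_scale_add)
  then show "(a + b) *\<^sub>C x = a *\<^sub>C x + b *\<^sub>C x" .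
  have one: "1 *\<^sub>C x = x" for x :: "('a, 'b) alg_tensor"
    by transfer (simp add: tens_scale_one tens_eq.refl)
  have "0 *\<^sub>C x = 0"
    by transfer (rule tens_scale_zero)
  then show "- x + x = 0"
    using scale_add[of "- 1" 1 x] by (simp add: uminus_alg_tensor_def one)
  show "x - y = x + - y"
    by (rule minus_alg_tensor_def)
  show scale_right: "a *\<^sub>C (x + y) = a *\<^sub>C x + a *\<^sub>C y" for a
    by transfer (simp add: tens_eq.refl)
  show scale_scale: "a *\<^sub>C b *\<^sub>C x = (a * b) *\<^sub>C x" for a b
    by transfer (simp add: tens_scale_scale tens_eq.refl)
  show "r *\<^sub>R (x + y) = r *\<^sub>R x + r *\<^sub>R y" "(r + r') *\<^sub>R x = r *\<^sub>R x + r' *\<^sub>R x"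
    "r *\<^sub>R r' *\<^sub>R x = (r * r') *\<^sub>R x" "1 *\<^sub>R x = x"
    by (simp_all add: scaleR_alg_tensor_def scale_right scale_add scale_scale one)
  show "r *\<^sub>R x = complex_of_real r *\<^sub>C x"
    by (rule scaleR_alg_tensor_def)
  show cadd: "cinner (x + y) z = cinner x z + cinner y z"
    by transfer simp
  show cscale: "cinner (a *\<^sub>C x) y = a * cinner x y" for a
    by transfer (rule tens_inner_scale)
  show comm: "cinner x y = cnj (cinner y x)"
    by transfer (rule tens_inner_commute)
  show "inner x y = Re (cinner x y)"
    by (rule inner_alg_tensor_def)
  show "inner x y = inner y x"
    using comm by (simp add: inner_alg_tensor_def)
  show "inner (x + y) z = inner x z + inner y z" "inner (r *\<^sub>R x) y = r * inner x y"
    by (simp_all add: inner_alg_tensor_def scaleR_alg_tensor_def cadd cscale)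
  show "0 \<le> inner x x" "inner x x = 0 \<longleftrightarrow> x = 0"
    unfolding inner_alg_tensor_def by (transfer, rule tens_inner_self)+
  show "norm x = sqrt (inner x x)"
    by (rule norm_alg_tensor_def)
  show "dist x y = norm (x - y)"
    by (rule dist_alg_tensor_def)
  show "sgn x = inverse (norm x) *\<^sub>R x"
    by (rule sgn_alg_tensor_def)
  show "(uniformity :: (('a, 'b) alg_tensor \<times> ('a, 'b) alg_tensor) filter)
      = (INF e\<in>{0 <..}. principal {(x, y). dist x y < e})"
    by (rule uniformity_alg_tensor_def)
  show "open U \<longleftrightarrow> (\<forall>x\<in>U. eventually (\<lambda>(x', y). x' = x \<longrightarrow> y \<in> U) uniformity)"
    for U :: "('a, 'b) alg_tensor set"
    by (rule open_alg_tensor_def)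
qed

end


section \<open>The completion of an inner product space\<close>

text \<open>
  Cauchy sequences modulo null sequences.
\<close>

lemma Cauchy_add_seq:
  fixes X Y :: "nat \<Rightarrow> 'a::real_normed_vector"
  assumes "Cauchy X" "Cauchy Y"
  shows "Cauchy (\<lambda>n. X n + Y n)"
proof (rule CauchyI)
  fix e :: real assume "0 < e"
  then have e: "0 < e / 2" by simp
  obtain M N where M: "\<forall>m\<ge>M. \<forall>n\<ge>M. norm (X m - X n) < e / 2"
    and N: "\<forall>m\<ge>N. \<forall>n\<ge>N. norm (Y m - Y n) < e / 2"
    using CauchyD[OF assms(1) e] CauchyD[OF assms(2) e] by blast
  show "\<exists>M. \<forall>m\<ge>M. \<forall>n\<ge>M. norm (X m + Y m - (X n + Y n)) < e"
  proof (intro exI[of _ "max M N"] allI impI)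
    fix m n assume "max M N \<le> m" "max M N \<le> n"
    then have "norm (X m - X n) < e / 2" "norm (Y m - Y n) < e / 2"
      using M N by auto
    then show "norm (X m + Y m - (X n + Y n)) < e"
      using norm_diff_triangle_ineq[of "X m" "Y m" "X n" "Y n"] by linarith
  qed
qed

lemma Cauchy_convergent_inner:
  fixes X Y :: "nat \<Rightarrow> 'a::real_inner"
  assumes "Cauchy X" "Cauchy Y"
  shows "convergent (\<lambda>n. inner (X n) (Y n))"
proof -
  have norm: "convergent (\<lambda>n. norm (Z n))" if "Cauchy Z" for Z :: "nat \<Rightarrow> 'a"
  proof -
    have "Cauchy (\<lambda>n. norm (Z n))"
    proof (rule CauchyI)
      fix e :: real assume "0 < e"
      then obtain M where "\<forall>m\<ge>M. \<forall>n\<ge>M. norm (Z m - Z n) < e"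
        using CauchyD[OF \<open>Cauchy Z\<close>] by blast
      then show "\<exists>M. \<forall>m\<ge>M. \<forall>n\<ge>M. norm (norm (Z m) - norm (Z n)) < e"
        by (metis norm_triangle_ineq3 real_norm_def order_le_less_trans)
    qed
    then show ?thesis by (simp add: Cauchy_convergent_iff)
  qed
  have "Cauchy (\<lambda>n. X n + Y n)"
    by (rule Cauchy_add_seq[OF assms])
  then obtain a b c where "(\<lambda>n. norm (X n + Y n)) \<longlonglongrightarrow> a" "(\<lambda>n. norm (X n)) \<longlonglongrightarrow> b"
    "(\<lambda>n. norm (Y n)) \<longlonglongrightarrow> c"
    using norm assms unfolding convergent_def by metis
  then have "(\<lambda>n. ((norm (X n + Y n))\<^sup>2 - (norm (X n))\<^sup>2 - (norm (Y n))\<^sup>2) / 2)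
      \<longlonglongrightarrow> (a\<^sup>2 - b\<^sup>2 - c\<^sup>2) / 2"
    by (intro tendsto_intros) simp_all
  then show ?thesis by (auto simp: dot_norm convergent_def)
qed

lemma Cauchy_scaleC: "Cauchy X \<Longrightarrow> Cauchy (\<lambda>n. a *\<^sub>C X n :: 'a::complex_inner)"
proof -
  have "bounded_linear (\<lambda>x :: 'a. a *\<^sub>C x)"
    by (rule bounded_linear_intro[of _ "cmod a"])
      (simp_all add: scaleC_add_right scaleR_eq_scaleC scaleC_scaleC norm_scaleC mult.commute)
  then show "Cauchy X \<Longrightarrow> Cauchy (\<lambda>n. a *\<^sub>C X n)"
    by (rule bounded_linear.Cauchy)
qed

lemma Cauchy_convergent_cinner:
  fixes X Y :: "nat \<Rightarrow> 'a::complex_inner"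
  assumes "Cauchy X" "Cauchy Y"
  shows "convergent (\<lambda>n. cinner (X n) (Y n))"
proof -
  obtain a b where "(\<lambda>n. inner (X n) (Y n)) \<longlonglongrightarrow> a" "(\<lambda>n. inner (X n) (\<i> *\<^sub>C Y n)) \<longlonglongrightarrow> b"
    using Cauchy_convergent_inner[OF assms] Cauchy_convergent_inner[OF assms(1) Cauchy_scaleC[OF assms(2)]]
    unfolding convergent_def by metis
  then have "(\<lambda>n. cinner (X n) (Y n)) \<longlonglongrightarrow> Complex a b"
    by (simp add: cinner_eq_Complex tendsto_Complex)
  then show ?thesis by (auto simp: convergent_def)
qed

definition cauchy_eq :: "(nat \<Rightarrow> 'a::complex_inner) \<Rightarrow> (nat \<Rightarrow> 'a) \<Rightarrow> bool" where
  "cauchy_eq X Y \<longleftrightarrow> Cauchy X \<and> Cauchy Y \<and> (\<lambda>n. X n - Y n) \<longlonglongrightarrow> 0"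

lemma cauchy_eq_refl [simp]: "cauchy_eq X X \<longleftrightarrow> Cauchy X"
  by (simp add: cauchy_eq_def)

lemma cauchy_eq_sym: "cauchy_eq X Y \<Longrightarrow> cauchy_eq Y X"
  using tendsto_minus[of "\<lambda>n. X n - Y n" 0 sequentially] by (auto simp: cauchy_eq_def)

lemma cauchy_eq_trans: "cauchy_eq X Y \<Longrightarrow> cauchy_eq Y Z \<Longrightarrow> cauchy_eq X Z"
  using tendsto_add[of "\<lambda>n. X n - Y n" 0 sequentially "\<lambda>n. Y n - Z n" 0]
  by (auto simp: cauchy_eq_def)

lemma cauchy_eq_add:
  assumes "cauchy_eq X X'" "cauchy_eq Y Y'"
  shows "cauchy_eq (\<lambda>n. X n + Y n) (\<lambda>n. X' n + Y' n)"
  using assms tendsto_add[of "\<lambda>n. X n - X' n" 0 sequentially "\<lambda>n. Y n - Y' n" 0]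
  by (auto simp: cauchy_eq_def Cauchy_add_seq algebra_simps)

lemma cauchy_eq_scaleC:
  assumes "cauchy_eq X Y"
  shows "cauchy_eq (\<lambda>n. a *\<^sub>C X n) (\<lambda>n. a *\<^sub>C Y n)"
proof -
  have "(\<lambda>n. norm (a *\<^sub>C (X n - Y n))) \<longlonglongrightarrow> 0"
    using assms by (auto simp: cauchy_eq_def norm_scaleC intro!: tendsto_mult_right_zero tendsto_norm_zero)
  then have "(\<lambda>n. a *\<^sub>C (X n - Y n)) \<longlonglongrightarrow> 0"
    by (rule tendsto_norm_zero_cancel)
  moreover have "a *\<^sub>C (x - y) = a *\<^sub>C x - a *\<^sub>C y" for x y :: 'a
    using scaleC_add_right[of a "x - y" y] by (simp add: algebra_simps)
  ultimately show ?thesis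
    using assms by (simp add: cauchy_eq_def Cauchy_scaleC)
qed

lemma cauchy_eq_cinner_left:
  assumes "cauchy_eq X X'" "Cauchy Y"
  shows "lim (\<lambda>n. cinner (X n) (Y n)) = lim (\<lambda>n. cinner (X' n) (Y n))"
proof -
  have X: "Cauchy X" "Cauchy X'" "(\<lambda>n. X n - X' n) \<longlonglongrightarrow> 0"
    using assms by (auto simp: cauchy_eq_def)
  obtain l l' where l: "(\<lambda>n. cinner (X n) (Y n)) \<longlonglongrightarrow> l"
    and l': "(\<lambda>n. cinner (X' n) (Y n)) \<longlonglongrightarrow> l'"
    using Cauchy_convergent_cinner X assms(2) unfolding convergent_def by metis
  obtain K where K: "\<And>n. norm (Y n) \<le> K"
    using Cauchy_Bseq[OF assms(2)] by (auto simp: Bseq_def)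
  have null: "(\<lambda>n. norm (X n - X' n) * K) \<longlonglongrightarrow> 0"
    using X(3) by (intro tendsto_mult_left_zero tendsto_norm_zero)
  have bound: "cmod (cinner (X n - X' n) (Y n)) \<le> norm (X n - X' n) * K" for n
    by (rule order.trans[OF cmod_cinner_le]) (simp add: K mult_left_mono)
  have "(\<lambda>n. cinner (X n - X' n) (Y n)) \<longlonglongrightarrow> 0"
    by (rule Lim_null_comparison[OF always_eventually null]) (simp add: bound)
  moreover have "(\<lambda>n. cinner (X n - X' n) (Y n)) \<longlonglongrightarrow> l - l'"
    unfolding cinner_diff_left by (rule tendsto_diff[OF l l'])
  ultimately have "l = l'"
    using LIMSEQ_unique by fastforce
  then show ?thesis
    using limI[OF l] limI[OF l'] by simp
qed

definition seq_cinner :: "(nat \<Rightarrow> 'a::complex_inner) \<Rightarrow> (nat \<Rightarrow> 'a) \<Rightarrow> complex" where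
  "seq_cinner X Y = lim (\<lambda>n. cinner (X n) (Y n))"

lemma seq_cinner_tendsto:
  "Cauchy X \<Longrightarrow> Cauchy Y \<Longrightarrow> (\<lambda>n. cinner (X n) (Y n)) \<longlonglongrightarrow> seq_cinner X Y"
  using Cauchy_convergent_cinner[of X Y] by (simp add: seq_cinner_def convergent_LIMSEQ_iff)

lemma seq_cinner_commute:
  assumes "Cauchy X" "Cauchy Y"
  shows "seq_cinner X Y = cnj (seq_cinner Y X)"
proof -
  have "(\<lambda>n. cnj (cinner (Y n) (X n))) \<longlonglongrightarrow> cnj (seq_cinner Y X)"
    by (intro tendsto_cnj seq_cinner_tendsto assms)
  then show ?thesis
    using seq_cinner_tendsto[OF assms] by (simp add: cinner_commute[symmetric] LIMSEQ_unique)
qed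

lemma seq_cinner_cong:
  assumes "cauchy_eq X X'" "cauchy_eq Y Y'"
  shows "seq_cinner X Y = seq_cinner X' Y'"
proof -
  have C: "Cauchy X" "Cauchy X'" "Cauchy Y" "Cauchy Y'"
    using assms by (auto simp: cauchy_eq_def)
  have "seq_cinner X Y = seq_cinner X' Y"
    unfolding seq_cinner_def by (rule cauchy_eq_cinner_left[OF assms(1) C(3)])
  also have "\<dots> = cnj (seq_cinner Y X')"
    by (rule seq_cinner_commute) (rule C)+
  also have "seq_cinner Y X' = seq_cinner Y' X'"
    unfolding seq_cinner_def by (rule cauchy_eq_cinner_left[OF assms(2) C(2)])
  also have "cnj \<dots> = seq_cinner X' Y'"
    by (rule seq_cinner_commute[symmetric]) (rule C)+
  finally show ?thesis .
qed

lemma seq_cinner_self: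
  assumes "Cauchy X"
  shows "(\<lambda>n. (norm (X n))\<^sup>2) \<longlonglongrightarrow> Re (seq_cinner X X)"
  using tendsto_Re[OF seq_cinner_tendsto[OF assms assms]] by (simp add: cinner_self)

quotient_type (overloaded) 'a completion =
  "nat \<Rightarrow> 'a::complex_inner" / partial: cauchy_eq
proof (rule part_equivpI)
  show "\<exists>X :: nat \<Rightarrow> 'a. cauchy_eq X X"
    by (rule exI[of _ "\<lambda>n. 0"]) (simp add: convergent_Cauchy convergent_const)
qed (auto intro!: sympI transpI intro: cauchy_eq_sym cauchy_eq_trans)

lift_definition to_completion :: "'a::complex_inner \<Rightarrow> 'a completion" is "\<lambda>x n. x"
  by (simp add: convergent_Cauchy convergent_const)

instantiation completion :: (complex_inner) complex_inner
begin

lift_definition zero_completion :: "'a completion" is "\<lambda>n. 0"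
  by (simp add: convergent_Cauchy convergent_const)

lift_definition plus_completion :: "'a completion \<Rightarrow> 'a completion \<Rightarrow> 'a completion"
  is "\<lambda>X Y n. X n + Y n" by (rule cauchy_eq_add)

lift_definition scaleC_completion :: "complex \<Rightarrow> 'a completion \<Rightarrow> 'a completion"
  is "\<lambda>a X n. a *\<^sub>C X n" by (rule cauchy_eq_scaleC)

lift_definition cinner_completion :: "'a completion \<Rightarrow> 'a completion \<Rightarrow> complex"
  is seq_cinner by (rule seq_cinner_cong)

definition uminus_completion :: "'a completion \<Rightarrow> 'a completion" where
  "- x = (- 1) *\<^sub>C (x :: 'a completion)"

definition minus_completion :: "'a completion \<Rightarrow> 'a completion \<Rightarrow> 'a completion" where
  "x - y = x + - (y :: 'a completion)"

definition scaleR_completion :: "real \<Rightarrow> 'a completion \<Rightarrow> 'a completion" where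
  "r *\<^sub>R x = complex_of_real r *\<^sub>C (x :: 'a completion)"

definition inner_completion :: "'a completion \<Rightarrow> 'a completion \<Rightarrow> real" where
  "inner x y = Re (cinner x (y :: 'a completion))"

definition norm_completion :: "'a completion \<Rightarrow> real" where
  "norm x = sqrt (inner x (x :: 'a completion))"

definition dist_completion :: "'a completion \<Rightarrow> 'a completion \<Rightarrow> real" where
  "dist x y = norm (x - y :: 'a completion)"

definition sgn_completion :: "'a completion \<Rightarrow> 'a completion" where
  "sgn x = inverse (norm x) *\<^sub>R (x :: 'a completion)"

definition uniformity_completion :: "('a completion \<times> 'a completion) filter" where [code del]:
  "uniformity_completion = (INF e\<in>{0 <..}. principal {(x, y :: 'a completion). dist x y < e})"

definition open_completion :: "'a completion set \<Rightarrow> bool" where [code del]: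
  "open_completion U \<longleftrightarrow>
    (\<forall>x\<in>U. eventually (\<lambda>(x', y :: 'a completion). x' = x \<longrightarrow> y \<in> U) uniformity)"

instance
proof
  have eqI: "cauchy_eq X Y" if "Cauchy X" "X = Y" for X Y :: "nat \<Rightarrow> 'a"
    using that by simp
  fix x y z :: "'a completion" and a b :: complex and r r' :: real
  show "x + y + z = x + (y + z)"
    by transfer (auto intro!: eqI Cauchy_add_seq simp: add.assoc)
  show "x + y = y + x"
    by transfer (auto intro!: eqI Cauchy_add_seq simp: add.commute)
  show "0 + x = x"
    by transfer auto
  have scale_add: "(a + b) *\<^sub>C x = a *\<^sub>C x + b *\<^sub>C x" for a b and x :: "'a completion"
    by transfer (auto intro!: eqI Cauchy_scaleC Cauchy_add_seq simp: scaleC_add_left)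
  then show "(a + b) *\<^sub>C x = a *\<^sub>C x + b *\<^sub>C x" .
  have one: "1 *\<^sub>C x = x" for x :: "'a completion"
    by transfer (auto simp: scaleC_one)
  have "0 *\<^sub>C x = 0"
    by transfer (auto simp: scaleC_zero_left convergent_Cauchy convergent_const)
  then show "- x + x = 0"
    using scale_add[of "- 1" 1 x] by (simp add: uminus_completion_def one)
  show "x - y = x + - y"
    by (rule minus_completion_def)
  show scale_right: "a *\<^sub>C (x + y) = a *\<^sub>C x + a *\<^sub>C y" for a
    by transfer (auto intro!: eqI Cauchy_scaleC Cauchy_add_seq simp: scaleC_add_right)
  show scale_scale: "a *\<^sub>C b *\<^sub>C x = (a * b) *\<^sub>C x" for a b
    by transfer (auto intro!: eqI Cauchy_scaleC simp: scaleC_scaleC)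
  show "r *\<^sub>R (x + y) = r *\<^sub>R x + r *\<^sub>R y" "(r + r') *\<^sub>R x = r *\<^sub>R x + r' *\<^sub>R x"
    "r *\<^sub>R r' *\<^sub>R x = (r * r') *\<^sub>R x" "1 *\<^sub>R x = x"
    by (simp_all add: scaleR_completion_def scale_right scale_add scale_scale one)
  show "r *\<^sub>R x = complex_of_real r *\<^sub>C x"
    by (rule scaleR_completion_def)
  show cadd: "cinner (x + y) z = cinner x z + cinner y z"
  proof (transfer, simp)
    fix X Y Z :: "nat \<Rightarrow> 'a" assume "Cauchy X" "Cauchy Y" "Cauchy Z"
    then have "(\<lambda>n. cinner (X n + Y n) (Z n)) \<longlonglongrightarrow> seq_cinner X Z + seq_cinner Y Z"
      unfolding cinner_add_left by (intro tendsto_add seq_cinner_tendsto)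
    then show "seq_cinner (\<lambda>n. X n + Y n) Z = seq_cinner X Z + seq_cinner Y Z"
      by (simp add: seq_cinner_def limI)
  qed
  show cscale: "cinner (a *\<^sub>C x) y = a * cinner x y" for a
  proof (transfer, simp)
    fix a and X Y :: "nat \<Rightarrow> 'a" assume "Cauchy X" "Cauchy Y"
    then have "(\<lambda>n. cinner (a *\<^sub>C X n) (Y n)) \<longlonglongrightarrow> a * seq_cinner X Y"
      unfolding cinner_scaleC_left by (intro tendsto_mult_left seq_cinner_tendsto)
    then show "seq_cinner (\<lambda>n. a *\<^sub>C X n) Y = a * seq_cinner X Y"
      by (simp add: seq_cinner_def limI)
  qed
  show comm: "cinner x y = cnj (cinner y x)"
    by transfer (rule seq_cinner_commute, simp_all)
  show "inner x y = Re (cinner x y)"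
    by (rule inner_completion_def)
  show "inner x y = inner y x"
    using comm by (simp add: inner_completion_def)
  show "inner (x + y) z = inner x z + inner y z" "inner (r *\<^sub>R x) y = r * inner x y"
    by (simp_all add: inner_completion_def scaleR_completion_def cadd cscale)
  show "0 \<le> inner x x"
    unfolding inner_completion_def
    by transfer (auto intro!: LIMSEQ_le_const[OF seq_cinner_self])
  show "inner x x = 0 \<longleftrightarrow> x = 0"
    unfolding inner_completion_def
  proof transfer
    fix X :: "nat \<Rightarrow> 'a" assume "cauchy_eq X X"
    then have X: "Cauchy X" by simp
    have "Re (seq_cinner X X) = 0 \<longleftrightarrow> (\<lambda>n. (norm (X n))\<^sup>2) \<longlonglongrightarrow> 0"
      using seq_cinner_self[OF X] LIMSEQ_unique by metis
    also have "\<dots> \<longleftrightarrow> X \<longlonglongrightarrow> 0"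
      by (subst tendsto_norm_zero_iff[symmetric], rule iffI)
        (use tendsto_real_sqrt[of "\<lambda>n. (norm (X n))\<^sup>2" 0 sequentially]
          tendsto_power[of "\<lambda>n. norm (X n)" 0 sequentially 2] in auto)
    finally show "Re (seq_cinner X X) = 0 \<longleftrightarrow> cauchy_eq X (\<lambda>n. 0)"
      using X by (simp add: cauchy_eq_def convergent_Cauchy convergent_const)
  qed
  show "norm x = sqrt (inner x x)"
    by (rule norm_completion_def)
  show "dist x y = norm (x - y)"
    by (rule dist_completion_def)
  show "sgn x = inverse (norm x) *\<^sub>R x"
    by (rule sgn_completion_def)
  show "(uniformity :: ('a completion \<times> 'a completion) filter)
      = (INF e\<in>{0 <..}. principal {(x, y). dist x y < e})"
    by (rule uniformity_completion_def)
  show "open U \<longleftrightarrow> (\<forall>x\<in>U. eventually (\<lambda>(x', y). x' = x \<longrightarrow> y \<in> U) uniformity)"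
    for U :: "'a completion set"
    by (rule open_completion_def)
qed

end

lemma to_completion_add: "to_completion (x + y) = to_completion x + to_completion y"
  by transfer (simp add: convergent_Cauchy convergent_const)

lemma to_completion_scaleC: "to_completion (a *\<^sub>C x) = a *\<^sub>C to_completion x"
  by transfer (simp add: convergent_Cauchy convergent_const)

lemma to_completion_diff: "to_completion (x - y) = to_completion x - to_completion y"
  using to_completion_add[of "x - y" y] by (simp add: algebra_simps)

lemma cinner_to_completion: "cinner (to_completion x) (to_completion y) = cinner x y"
  by transfer (simp add: seq_cinner_def)

lemma norm_to_completion: "norm (to_completion x) = norm x"
  by (simp add: norm_eq_sqrt_inner inner_eq_Re_cinner cinner_to_completion)

lemma to_completion_tendsto:
  assumes "Cauchy X"
  shows "(\<lambda>n. to_completion (X n)) \<longlonglongrightarrow> abs_completion X"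
proof (rule LIMSEQ_I)
  fix e :: real assume "0 < e"
  then obtain M where M: "\<forall>m\<ge>M. \<forall>n\<ge>M. norm (X m - X n) < e / 2"
    using CauchyD[OF assms, of "e / 2"] by auto
  have "norm (to_completion (X n) - abs_completion X) < e" if "n \<ge> M" for n
  proof -
    define Y where "Y k = X n + (- 1) *\<^sub>C X k" for k
    have C: "Cauchy (\<lambda>k. X n)"
      by (simp add: convergent_Cauchy convergent_const)
    have Y: "Cauchy Y"
      unfolding Y_def by (intro Cauchy_add_seq Cauchy_scaleC assms C)
    have 1: "to_completion (X n) - abs_completion X = abs_completion Y"
      using assms C Cauchy_scaleC[OF assms, of "- 1"]
      by (simp add: minus_completion_def uminus_completion_def to_completion.abs_eq
          scaleC_completion.abs_eq plus_completion.abs_eq Y_def[abs_def])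
    have 2: "(norm (abs_completion Y))\<^sup>2 = Re (seq_cinner Y Y)"
      using Y by (simp add: power2_norm_eq_inner inner_eq_Re_cinner cinner_completion.abs_eq)
    have 3: "Re (seq_cinner Y Y) \<le> (e / 2)\<^sup>2"
    proof (rule LIMSEQ_le_const2[OF seq_cinner_self[OF Y]], intro exI[of _ M] allI impI)
      fix k assume "M \<le> k"
      then have "norm (Y k) \<le> e / 2"
        using M \<open>n \<ge> M\<close> by (simp add: Y_def scaleC_minus1 less_imp_le)
      then show "(norm (Y k))\<^sup>2 \<le> (e / 2)\<^sup>2"
        by (simp add: power_mono)
    qed
    have "norm (abs_completion Y) \<le> e / 2"
    proof (rule power2_le_imp_le)
      show "(norm (abs_completion Y))\<^sup>2 \<le> (e / 2)\<^sup>2"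
        unfolding 2 by (rule 3)
    qed (use \<open>0 < e\<close> in simp)
    then show ?thesis
      unfolding 1 using \<open>0 < e\<close> by linarith
  qed
  then show "\<exists>M. \<forall>n\<ge>M. norm (to_completion (X n) - abs_completion X) < e"
    by blast
qed

lemma to_completion_dense: "closure (range to_completion) = (UNIV :: 'a::complex_inner completion set)"
proof -
  have "x \<in> closure (range to_completion)" for x :: "'a completion"
  proof (induction x rule: completion.abs_induct)
    case (1 X)
    then have "(\<lambda>n. to_completion (X n)) \<longlonglongrightarrow> abs_completion X"
      by (simp add: to_completion_tendsto)
    then show ?case
      unfolding closure_sequential by (intro exI[of _ "\<lambda>n. to_completion (X n)"]) simp
  qed
  then show ?thesis by blast
qed

instance completion :: (complex_inner) chilbert_space
proof
  fix x :: "nat \<Rightarrow> 'a completion" assume x: "Cauchy x"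
  have "\<exists>a. norm (to_completion a - x n) < 1 / Suc n" for n
  proof -
    have "x n \<in> closure (range to_completion)"
      by (simp add: to_completion_dense)
    then have "\<exists>y\<in>range to_completion. dist y (x n) < 1 / Suc n"
      unfolding closure_approachable by simp
    then show ?thesis by (auto simp: dist_norm)
  qed
  then obtain a where a: "\<And>n. norm (to_completion (a n) - x n) < 1 / Suc n"
    by metis
  have "(\<lambda>n. norm (to_completion (a n) - x n)) \<longlonglongrightarrow> 0"
    by (rule real_tendsto_sandwich[OF _ _ tendsto_const lim_1_over_n[THEN LIMSEQ_Suc]])
      (use a in \<open>auto intro!: always_eventually less_imp_le\<close>)
  then have ax: "(\<lambda>n. to_completion (a n) - x n) \<longlonglongrightarrow> 0"
    by (rule tendsto_norm_zero_cancel)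
  have "Cauchy (\<lambda>n. (to_completion (a n) - x n) + x n)"
    using ax by (intro Cauchy_add_seq LIMSEQ_imp_Cauchy x)
  then have "Cauchy (\<lambda>n. to_completion (a n))" by simp
  then have "Cauchy a"
    unfolding Cauchy_iff by (simp add: to_completion_diff[symmetric] norm_to_completion)
  then have "(\<lambda>n. to_completion (a n) - (to_completion (a n) - x n)) \<longlonglongrightarrow> abs_completion a - 0"
    by (intro tendsto_diff to_completion_tendsto ax)
  then show "convergent x" by (auto simp: convergent_def)
qed


section \<open>The Hilbert space tensor product\<close>

type_synonym ('a, 'b) hilbert_tensor = "('a, 'b) alg_tensor completion"

definition tensor ::
  "'a::chilbert_space \<Rightarrow> 'b::chilbert_space \<Rightarrow> ('a, 'b) hilbert_tensor" (infixr "\<otimes>\<^sub>v" 70) where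
  "x \<otimes>\<^sub>v y = to_completion (alg_tens x y)"

lemma tensor_add_left: "(x + x') \<otimes>\<^sub>v y = x \<otimes>\<^sub>v y + x' \<otimes>\<^sub>v y"
proof -
  have "alg_tens (x + x') y = alg_tens x y + alg_tens x' y"
    by transfer (simp add: add_mset_commute tens_eq.add_left)
  then show ?thesis by (simp add: tensor_def to_completion_add)
qed

lemma tensor_add_right: "x \<otimes>\<^sub>v (y + y') = x \<otimes>\<^sub>v y + x \<otimes>\<^sub>v y'"
proof -
  have "alg_tens x (y + y') = alg_tens x y + alg_tens x y'"
    by transfer (simp add: add_mset_commute tens_eq.add_right)
  then show ?thesis by (simp add: tensor_def to_completion_add)
qed

lemma tensor_scaleC_left: "(a *\<^sub>C x) \<otimes>\<^sub>v y = a *\<^sub>C (x \<otimes>\<^sub>v y)"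
proof -
  have "alg_tens (a *\<^sub>C x) y = a *\<^sub>C alg_tens x y"
    by transfer (simp add: tens_eq.refl)
  then show ?thesis by (simp add: tensor_def to_completion_scaleC)
qed

lemma tensor_scaleC_right: "x \<otimes>\<^sub>v (a *\<^sub>C y) = a *\<^sub>C (x \<otimes>\<^sub>v y)"
proof -
  have "alg_tens x (a *\<^sub>C y) = a *\<^sub>C alg_tens x y"
    by transfer (simp add: tens_eq.sym tens_eq.scale)
  then show ?thesis by (simp add: tensor_def to_completion_scaleC)
qed

lemma cinner_tensor: "cinner (x \<otimes>\<^sub>v y) (z \<otimes>\<^sub>v u) = cinner x z * cinner y u"
proof -
  have "cinner (alg_tens x y) (alg_tens z u) = cinner x z * cinner y u"
    by transfer (simp add: tens_inner_def)
  then show ?thesis by (simp add: tensor_def cinner_to_completion)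
qed

lemma range_to_completion_eq_span:
  "range to_completion = span (range (\<lambda>(x :: 'a::chilbert_space, y :: 'b::chilbert_space). x \<otimes>\<^sub>v y))"
    (is "?L = span ?R")
proof (intro equalityI subsetI)
  fix v assume "v \<in> ?L"
  then obtain t where v: "v = to_completion t" by blast
  have "to_completion (abs_alg_tensor s) \<in> span ?R" for s :: "('a \<times> 'b) multiset"
  proof (induction s)
    case empty
    have "to_completion (abs_alg_tensor {#} :: ('a, 'b) alg_tensor) = 0"
      using to_completion_diff[of "0 :: ('a, 'b) alg_tensor" 0]
      by (simp add: zero_alg_tensor.abs_eq[symmetric])
    then show ?case by (simp add: span_zero)
  next
    case (add p s)
    have "abs_alg_tensor (add_mset p s) = alg_tens (fst p) (snd p) + abs_alg_tensor s"
      by (simp add: alg_tens.abs_eq plus_alg_tensor.abs_eq)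
    then have "to_completion (abs_alg_tensor (add_mset p s))
        = fst p \<otimes>\<^sub>v snd p + to_completion (abs_alg_tensor s)"
      by (simp add: to_completion_add tensor_def)
    moreover have "fst p \<otimes>\<^sub>v snd p \<in> span ?R"
      by (rule span_base) (rule image_eqI[of _ _ p], simp_all add: case_prod_beta)
    ultimately show ?case
      using add by (simp add: span_add)
  qed
  then show "v \<in> span ?R"
    unfolding v by (induction t rule: alg_tensor.abs_induct)
next
  fix v assume "v \<in> span ?R"
  then show "v \<in> ?L"
  proof (induction rule: span_induct_alt)
    case base
    show ?case
      using to_completion_diff[of "0 :: ('a, 'b) alg_tensor" 0] by (intro image_eqI[of _ _ 0]) simp_all
  next
    case (step c p w)
    then obtain x y t where "p = to_completion (alg_tens x y)" "w = to_completion t"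
      by (auto simp: tensor_def)
    then have "c *\<^sub>R p + w = to_completion (c *\<^sub>R alg_tens x y + t)"
      by (simp add: scaleR_eq_scaleC to_completion_add to_completion_scaleC)
    then show ?case by blast
  qed
qed

lemma tensor_dense:
  "closure (span (range (\<lambda>(x :: 'a::chilbert_space, y :: 'b::chilbert_space). x \<otimes>\<^sub>v y))) = UNIV"
  by (metis range_to_completion_eq_span to_completion_dense)


section \<open>Bounded operators\<close>

text \<open>
  The descriptions \<open>THE\<close> below pick the operator that is determined by the stated property: by
  density of the elementary tensors (fact \<open>tensor_dense\<close>), by the Riesz representation theorem,
  and by uniqueness of positive square roots.  The operator norm is the library's
  \<^const>\<open>onorm\<close>.
\<close>

definition bounded_clinear :: "('a::complex_inner \<Rightarrow> 'b::complex_inner) \<Rightarrow> bool" where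
  "bounded_clinear T \<longleftrightarrow> bounded_linear T \<and> (\<forall>a x. T (a *\<^sub>C x) = a *\<^sub>C T x)"

definition tensor_op ::
  "('a::chilbert_space \<Rightarrow> 'a) \<Rightarrow> ('b::chilbert_space \<Rightarrow> 'b)
    \<Rightarrow> ('a, 'b) hilbert_tensor \<Rightarrow> ('a, 'b) hilbert_tensor" (infixr "\<otimes>\<^sub>o" 70) where
  "A \<otimes>\<^sub>o B = (THE T. bounded_clinear T \<and> (\<forall>x y. T (x \<otimes>\<^sub>v y) = A x \<otimes>\<^sub>v B y))"

definition adj :: "('a::chilbert_space \<Rightarrow> 'a) \<Rightarrow> 'a \<Rightarrow> 'a" where
  "adj T = (THE S. bounded_clinear S \<and> (\<forall>x y. cinner (T x) y = cinner x (S y)))"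

definition positive_op :: "('a::chilbert_space \<Rightarrow> 'a) \<Rightarrow> bool" where
  "positive_op T \<longleftrightarrow> bounded_clinear T \<and> (\<forall>x. cinner (T x) x \<in> \<real> \<and> 0 \<le> Re (cinner (T x) x))"

definition sqrt_op :: "('a::chilbert_space \<Rightarrow> 'a) \<Rightarrow> 'a \<Rightarrow> 'a" where
  "sqrt_op T = (THE S. positive_op S \<and> S \<circ> S = T)"

definition abs_op :: "('a::chilbert_space \<Rightarrow> 'a) \<Rightarrow> 'a \<Rightarrow> 'a" where
  "abs_op T = sqrt_op (adj T \<circ> T)"

definition Re_op :: "('a::chilbert_space \<Rightarrow> 'a) \<Rightarrow> 'a \<Rightarrow> 'a" where
  "Re_op T = (\<lambda>x. (1 / 2) *\<^sub>C (T x + adj T x))"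

text \<open>
  The supremum is taken in the nonnegative reals: adjoining 0 only matters on the zero space, where
  there is no unit vector.
\<close>

definition numerical_radius :: "('a::chilbert_space \<Rightarrow> 'a) \<Rightarrow> real" where
  "numerical_radius T = Sup (insert 0 {cmod (cinner (T x) x) |x. norm x = 1})"

end

theory Submission
  imports Defs
begin

text \<open>
  Put \<open>T = A \<otimes> B\<close>, \<open>P = \<bar>A\<bar> \<otimes> \<bar>B\<bar>\<close> and \<open>Q = \<bar>A\<^sup>*\<bar> \<otimes> \<bar>B\<^sup>*\<bar>\<close>.  Then \<open>P\<close> and \<open>Q\<close> are positive with
  \<open>P\<^sup>2 = T\<^sup>* T\<close> and \<open>Q\<^sup>2 = T T\<^sup>*\<close>, and the middle expression of the theorem is
  \<open>\<parallel>P\<^sup>2 + Q\<^sup>2\<parallel> / 4 + \<parallel>Re (P Q)\<parallel> / 2\<close>.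

  The first inequality is the mixed Schwarz inequality \<open>\<bar>\<langle>T x, x\<rangle>\<bar>\<^sup>2 \<le> \<langle>P x, x\<rangle> \<langle>Q x, x\<rangle>\<close>
  (\<open>mixed_Schwarz\<close>) followed by the arithmetic-geometric mean inequality and
  \<open>(P + Q)\<^sup>2 = P\<^sup>2 + Q\<^sup>2 + 2 Re (P Q)\<close> (\<open>numerical_radius_sq_le\<close>).

  The second one needs two norm bounds.  Expanding \<open>\<parallel>(T\<^sup>* T + T T\<^sup>*) x\<parallel>\<^sup>2\<close> gives
  \<open>\<parallel>P\<^sup>2 + Q\<^sup>2\<parallel> \<le> \<parallel>T\<parallel>\<^sup>2 + \<parallel>T\<^sup>2\<parallel>\<close> (\<open>norm_adjoint_products_sum_le\<close>), and \<open>\<parallel>\<bar>A\<bar> \<bar>A\<^sup>*\<bar>\<parallel> \<le> \<parallel>A\<^sup>2\<parallel>\<close>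
  (\<open>norm_abs_op_abs_op_adj_le\<close>) bounds \<open>\<parallel>Re (P Q)\<parallel>\<close> by \<open>m\<^sup>2 = \<parallel>A\<^sup>2\<parallel> \<parallel>B\<^sup>2\<parallel>\<close>.  With \<open>a = \<parallel>A\<parallel> \<parallel>B\<parallel>\<close> the middle
  expression is at most \<open>(a\<^sup>2 + 3 m\<^sup>2) / 4\<close>, and this is at most \<open>(a + m)\<^sup>2 / 4 \<le> a\<^sup>2\<close> because
  \<open>m \<le> a\<close>.

  The operator theory behind this is developed first, for real inner products as far as possible:
  adjoints from the Riesz representation theorem, and square roots of positive operators as limits
  of an iteration that visibly respects intertwining operators.  The relation \<open>T P = Q T\<close> and the
  uniqueness of positive roots follow from this property, and so does complex linearity of the
  roots.  That \<open>A \<otimes> B\<close> exists with \<open>\<parallel>A \<otimes> B\<parallel> \<le> \<parallel>A\<parallel> \<parallel>B\<parallel>\<close> follows from writing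
  \<open>\<parallel>A\<parallel>\<^sup>2 \<parallel>B\<parallel>\<^sup>2 - A\<^sup>* A \<otimes> B\<^sup>* B\<close> as a sum of squares on the
  algebraic tensor product (\<open>tens_inner_tens_map_le\<close>).
\<close>

section \<open>Riesz representation and adjoints\<close>

text \<open>
  The representing vector is the minimiser of \<open>J x = \<parallel>x\<parallel>\<^sup>2 / 2 - f x\<close>: the parallelogram law makes
  every minimising sequence Cauchy, and the derivative of \<open>J\<close> vanishes at the minimum.
\<close>

lemma riesz_representation:
  fixes f :: "'a::{real_inner, banach} \<Rightarrow> real"
  assumes "bounded_linear f"
  shows "\<exists>y. \<forall>x. f x = inner x y"
proof -
  interpret f: bounded_linear f by fact
  obtain K where K: "\<And>x. norm (f x) \<le> norm x * K"
    using f.bounded by blast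
  define J where "J x = (norm x)\<^sup>2 / 2 - f x" for x
  have J_lower: "- K\<^sup>2 / 2 \<le> J x" for x
  proof -
    have "f x \<le> norm x * K" using K[of x] by simp
    moreover have "0 \<le> (norm x - K)\<^sup>2" by simp
    ultimately show ?thesis by (simp add: J_def power2_diff)
  qed
  define d where "d = (INF x. J x)"
  have bdd: "bdd_below (range J)"
    using J_lower by (intro bdd_belowI2)
  have d_le: "d \<le> J x" for x
    unfolding d_def using bdd by (intro cINF_lower) simp_all
  have near: "\<exists>x. J x < d + e" if "0 < e" for e
    using cInf_lessD[of "range J" "d + e"] that by (auto simp: d_def)
  then have "\<exists>x. J x < d + inverse (Suc n)" for n
    by simp
  then obtain X where X: "\<And>n. J (X n) < d + inverse (Suc n)"
    by metis
  have parallelogram: "(norm (x - y))\<^sup>2 / 4 = J x + J y - 2 * J ((1 / 2) *\<^sub>R (x + y))" for x y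
    by (simp add: J_def f.add f.scaleR power2_norm_eq_inner inner_diff inner_add inner_commute
        field_simps)
  have close: "(norm (X m - X n))\<^sup>2 < 8 * inverse (Suc N)" if "N \<le> m" "N \<le> n" for m n N
  proof -
    have "inverse (Suc m) \<le> inverse (real (Suc N))" "inverse (Suc n) \<le> inverse (real (Suc N))"
      using that by (simp_all add: le_imp_inverse_le)
    then show ?thesis
      using parallelogram[of "X m" "X n"] X[of m] X[of n] d_le[of "(1 / 2) *\<^sub>R (X m + X n)"]
      by linarith
  qed
  have "Cauchy X"
  proof (rule CauchyI)
    fix e :: real assume e: "0 < e"
    then have "0 < e\<^sup>2 / 8" by simp
    then obtain N where N: "inverse (Suc N) < e\<^sup>2 / 8"
      using reals_Archimedean by blast
    have "norm (X m - X n) < e" if "N \<le> m" "N \<le> n" for m n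
    proof (rule power2_less_imp_less)
      show "(norm (X m - X n))\<^sup>2 < e\<^sup>2"
        using close[OF that] N by linarith
    qed (use e in simp)
    then show "\<exists>M. \<forall>m\<ge>M. \<forall>n\<ge>M. norm (X m - X n) < e" by blast
  qed
  then obtain y where y: "X \<longlonglongrightarrow> y"
    using Cauchy_convergent convergent_def by blast
  have "(\<lambda>n. J (X n)) \<longlonglongrightarrow> J y"
    unfolding J_def by (intro tendsto_intros y f.tendsto) simp_all
  moreover have "(\<lambda>n. d + inverse (real (Suc n))) \<longlonglongrightarrow> d + 0"
    by (intro tendsto_intros LIMSEQ_inverse_real_of_nat)
  ultimately have "J y \<le> d + 0"
    using X by (intro LIMSEQ_le) (auto intro: less_imp_le)
  then have min: "J y \<le> J x" for x
    using d_le[of x] by simp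
  have "f x = inner x y" for x
  proof (rule ccontr)
    define b where "b = inner x y - f x"
    assume "f x \<noteq> inner x y"
    then have b: "b \<noteq> 0" and x: "x \<noteq> 0"
      by (auto simp: b_def f.zero)
    \<comment> \<open>the step that minimises the quadratic polynomial \<open>t \<mapsto> J (y + t x)\<close>\<close>
    define t where "t = - b / (norm x)\<^sup>2"
    have "J (y + t *\<^sub>R x) = J y + (t * b + t\<^sup>2 * (norm x)\<^sup>2 / 2)"
      unfolding J_def power2_norm_eq_inner
      by (simp add: b_def f.add f.scaleR inner_add inner_commute field_simps power2_eq_square[of t])
    also have "t * b + t\<^sup>2 * (norm x)\<^sup>2 / 2 = - b\<^sup>2 / (2 * (norm x)\<^sup>2)"
      using x by (simp add: t_def field_simps power2_eq_square)
    also have "\<dots> < 0" using b x by (simp add: field_simps)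
    finally show False using min[of "y + t *\<^sub>R x"] by simp
  qed
  then show ?thesis by blast
qed

lemma eq_if_inner_eq:
  fixes x y :: "'a::real_inner"
  assumes "\<And>z. inner z x = inner z y"
  shows "x = y"
proof -
  have "inner (x - y) (x - y) = 0"
    using assms[of "x - y"] by (simp only: inner_diff_right)
  then show ?thesis by simp
qed

lemma real_adjoint_exists:
  fixes T :: "'a::{real_inner, banach} \<Rightarrow> 'b::real_inner"
  assumes "bounded_linear T"
  shows "\<exists>S. bounded_linear S \<and> (\<forall>x y. inner (T x) y = inner x (S y))"
proof -
  interpret T: bounded_linear T by fact
  have "bounded_linear (\<lambda>x. inner (T x) y)" for y
    using bounded_linear_compose[OF bounded_linear_inner_left assms] .
  then have "\<exists>z. \<forall>x. inner (T x) y = inner x z" for y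
    by (rule riesz_representation)
  then obtain S where S: "\<And>x y. inner (T x) y = inner x (S y)"
    by metis
  obtain K where K0: "0 \<le> K" and K: "\<And>x. norm (T x) \<le> norm x * K"
    using T.nonneg_bounded by blast
  have "bounded_linear S"
  proof (rule bounded_linear_intro)
    show "S (x + y) = S x + S y" for x y
      by (rule eq_if_inner_eq) (simp add: inner_add_right S[symmetric])
    show "S (r *\<^sub>R x) = r *\<^sub>R S x" for r x
      by (rule eq_if_inner_eq) (simp add: S[symmetric])
    show "norm (S y) \<le> norm y * K" for y
    proof (cases "S y = 0")
      case True
      then show ?thesis using K0 by simp
    next
      case False
      have "norm (S y) * norm (S y) = inner (T (S y)) y"
        by (simp add: S dot_square_norm power2_eq_square)
      also have "\<dots> \<le> norm (T (S y)) * norm y"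
        by (rule norm_cauchy_schwarz)
      also have "\<dots> \<le> norm (S y) * (norm y * K)"
        using mult_right_mono[OF K[of "S y"], of "norm y"] by (simp add: mult_ac)
      finally show ?thesis using False by simp
    qed
  qed
  with S show ?thesis by blast
qed


section \<open>Positive operators and their square roots\<close>

text \<open>
  Symmetry is part of the notion because over the reals it does not follow from the sign of the
  quadratic form.
\<close>

definition pos_sym :: "('a::real_inner \<Rightarrow> 'a) \<Rightarrow> bool" where
  "pos_sym T \<longleftrightarrow> bounded_linear T \<and> (\<forall>x y. inner (T x) y = inner x (T y)) \<and> (\<forall>x. 0 \<le> inner (T x) x)"

lemma pos_symD:
  assumes "pos_sym T"
  shows "bounded_linear T" "inner (T x) y = inner x (T y)" "0 \<le> inner (T x) x"
  using assms by (auto simp: pos_sym_def)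

lemma pos_sym_Cauchy_Schwarz:
  assumes "pos_sym T"
  shows "(inner (T x) y)\<^sup>2 \<le> inner (T x) x * inner (T y) y"
proof -
  interpret T: bounded_linear T using assms by (rule pos_symD)
  define a b c where "a = inner (T x) x" and "b = inner (T x) y" and "c = inner (T y) y"
  have quad: "0 \<le> a + 2 * t * b + t\<^sup>2 * c" for t
  proof -
    have "inner (T y) x = b"
      using pos_symD(2)[OF assms, of y x] by (simp add: b_def inner_commute)
    then have "inner (T (x + t *\<^sub>R y)) (x + t *\<^sub>R y) = a + 2 * t * b + t\<^sup>2 * c"
      by (simp add: a_def b_def c_def T.add T.scaleR inner_add power2_eq_square algebra_simps)
    then show ?thesis using pos_symD(3)[OF assms] by metis
  qed
  have c: "0 \<le> c" unfolding c_def using assms by (rule pos_symD)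
  have "b\<^sup>2 \<le> a * c"
  proof (cases "c = 0")
    case True
    have "b = 0"
    proof (rule ccontr)
      assume "b \<noteq> 0"
      then have "a + 2 * (- (a + 1) / (2 * b)) * b = - 1" by (simp add: field_simps)
      then show False using quad[of "- (a + 1) / (2 * b)"] by (simp add: True)
    qed
    then show ?thesis by (simp add: True)
  next
    case False
    with c have "0 < c" by simp
    then have "a + 2 * (- b / c) * b + (- b / c)\<^sup>2 * c = a - b\<^sup>2 / c"
      by (simp add: field_simps power2_eq_square)
    then have "b\<^sup>2 / c \<le> a" using quad[of "- b / c"] by simp
    then show ?thesis using \<open>0 < c\<close> by (simp add: field_simps)
  qed
  then show ?thesis by (simp add: a_def b_def c_def)
qed

lemma pos_sym_norm_sq_le:
  assumes "pos_sym T" and bound: "\<And>x. norm (T x) \<le> c * norm x"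
  shows "(norm (T x))\<^sup>2 \<le> c * inner (T x) x"
proof (cases "T x = 0")
  case False
  have "((norm (T x))\<^sup>2)\<^sup>2 \<le> inner (T x) x * inner (T (T x)) (T x)"
    using pos_sym_Cauchy_Schwarz[OF assms(1), of x "T x"] by (simp add: power2_norm_eq_inner)
  also have "inner (T (T x)) (T x) \<le> c * (norm (T x))\<^sup>2"
    using norm_cauchy_schwarz[of "T (T x)" "T x"] mult_right_mono[OF bound[of "T x"], of "norm (T x)"]
    by (simp add: power2_eq_square mult.assoc)
  then have "inner (T x) x * inner (T (T x)) (T x) \<le> inner (T x) x * (c * (norm (T x))\<^sup>2)"
    using pos_symD(3)[OF assms(1), of x] by (rule mult_left_mono)
  finally have "(norm (T x))\<^sup>2 * (norm (T x))\<^sup>2 \<le> (c * inner (T x) x) * (norm (T x))\<^sup>2"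
    by (simp add: power2_eq_square mult_ac)
  then show ?thesis
    by (rule mult_right_le_imp_le) (simp add: False)
qed simp_all

text \<open>The quantitative form of \<open>0 \<le> c - T \<le> c\<close>.\<close>

lemma pos_sym_complement_contraction:
  assumes "pos_sym T" and bound: "\<And>x. norm (T x) \<le> c * norm x" and "0 \<le> c"
  shows "norm (c *\<^sub>R x - T x) \<le> c * norm x"
proof (rule power2_le_imp_le)
  have "(norm (c *\<^sub>R x - T x))\<^sup>2 = c\<^sup>2 * (norm x)\<^sup>2 - 2 * c * inner (T x) x + (norm (T x))\<^sup>2"
    unfolding power2_norm_eq_inner
    by (simp add: inner_diff inner_commute algebra_simps power2_eq_square[of c])
  also have "\<dots> \<le> c\<^sup>2 * (norm x)\<^sup>2 - c * inner (T x) x"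
    using pos_sym_norm_sq_le[OF assms(1) bound, of x] by simp
  also have "\<dots> \<le> c\<^sup>2 * (norm x)\<^sup>2"
    using pos_symD(3)[OF assms(1), of x] \<open>0 \<le> c\<close> by simp
  finally show "(norm (c *\<^sub>R x - T x))\<^sup>2 \<le> (c * norm x)\<^sup>2"
    by (simp add: power_mult_distrib)
qed (use \<open>0 \<le> c\<close> in simp)

text \<open>
  If \<open>Y = (X + Y\<^sup>2) / 2\<close> then \<open>(1 - Y)\<^sup>2 = 1 - X\<close>.  The iteration below solves this equation for a
  contraction \<open>X\<close>; the scalar iteration for \<open>X = 1\<close> majorises it.
\<close>

primrec sqrt_iter :: "('a::real_vector \<Rightarrow> 'a) \<Rightarrow> nat \<Rightarrow> 'a \<Rightarrow> 'a" where
  "sqrt_iter X 0 = (\<lambda>x. 0)"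
| "sqrt_iter X (Suc n) = (\<lambda>x. (1 / 2) *\<^sub>R (X x + sqrt_iter X n (sqrt_iter X n x)))"

primrec sqrt_majorant :: "nat \<Rightarrow> real" where
  "sqrt_majorant 0 = 0"
| "sqrt_majorant (Suc n) = (1 + (sqrt_majorant n)\<^sup>2) / 2"

lemma sqrt_majorant_bounds: "0 \<le> sqrt_majorant n" "sqrt_majorant n \<le> 1"
proof -
  have "0 \<le> sqrt_majorant n \<and> sqrt_majorant n \<le> 1"
  proof (induction n)
    case (Suc n)
    then have "(sqrt_majorant n)\<^sup>2 \<le> 1" by (simp add: power_le_one)
    then show ?case by simp
  qed simp
  then show "0 \<le> sqrt_majorant n" "sqrt_majorant n \<le> 1" by simp_all
qed

lemma sqrt_majorant_Cauchy: "Cauchy sqrt_majorant"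
proof -
  have "sqrt_majorant n \<le> sqrt_majorant (Suc n)" for n
    using zero_le_power2[of "sqrt_majorant n - 1"] by (simp add: power2_diff)
  then have "incseq sqrt_majorant" by (rule incseq_SucI)
  moreover have "Bseq sqrt_majorant"
    using sqrt_majorant_bounds by (intro BseqI'[of _ 1]) simp
  ultimately show ?thesis
    by (intro convergent_Cauchy Bseq_mono_convergent) (auto simp: incseq_def)
qed

lemma sqrt_iter_bounded_linear: "bounded_linear X \<Longrightarrow> bounded_linear (sqrt_iter X n)"
  by (induction n)
    (simp_all add: bounded_linear_zero bounded_linear_const_scaleR bounded_linear_add bounded_linear_compose)

lemma sqrt_iter_norm:
  assumes "\<And>x. norm (X x) \<le> norm x"
  shows "norm (sqrt_iter X n x) \<le> sqrt_majorant n * norm x"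
proof (induction n arbitrary: x)
  case (Suc n)
  let ?Y = "sqrt_iter X n" and ?m = "sqrt_majorant n"
  have "norm (?Y (?Y x)) \<le> ?m * (?m * norm x)"
    using Suc[of "?Y x"] mult_left_mono[OF Suc[of x] sqrt_majorant_bounds(1)] by (rule order_trans)
  then have "norm (X x + ?Y (?Y x)) \<le> norm x + ?m * (?m * norm x)"
    using norm_triangle_ineq[of "X x" "?Y (?Y x)"] assms[of x] by linarith
  then have "norm (X x + ?Y (?Y x)) / 2 \<le> (norm x + ?m * (?m * norm x)) / 2"
    by simp
  also have "\<dots> = sqrt_majorant (Suc n) * norm x"
    by (simp add: field_simps power2_eq_square)
  finally show ?case by (simp del: scaleR_add_right)
qed simp

text \<open>
  The identity \<open>Z\<^sup>2 - Y\<^sup>2 = Z (Z - Y) + (Z - Y) Y\<close> for consecutive iterates \<open>Y\<close>, \<open>Z\<close> gives the norm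
  estimate whose scalar version is the exact formula \<open>b\<^sup>2 - a\<^sup>2 = b (b - a) + (b - a) a\<close> for the
  majorants.  So the increments are dominated by those of a bounded monotone sequence.
\<close>

lemma sqrt_iter_step:
  fixes X :: "'a::real_normed_vector \<Rightarrow> 'a"
  assumes "bounded_linear X" and X: "\<And>x. norm (X x) \<le> norm x"
  shows "norm (sqrt_iter X (Suc n) x - sqrt_iter X n x)
    \<le> (sqrt_majorant (Suc n) - sqrt_majorant n) * norm x"
proof (induction n arbitrary: x)
  case 0
  show ?case using X[of x] by simp
next
  case (Suc n)
  define Y Z a b where "Y = sqrt_iter X n" and "Z = sqrt_iter X (Suc n)"
    and "a = sqrt_majorant n" and "b = sqrt_majorant (Suc n)"
  interpret Z: bounded_linear Z
    unfolding Z_def by (rule sqrt_iter_bounded_linear[OF assms(1)])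
  have IH: "norm (Z x - Y x) \<le> (b - a) * norm x" for x
    using Suc[of x] by (simp only: Y_def Z_def a_def b_def)
  have Y: "norm (Y x) \<le> a * norm x" and Z: "norm (Z x) \<le> b * norm x" for x
    unfolding Y_def Z_def a_def b_def by (rule sqrt_iter_norm[OF X])+
  have ab: "0 \<le> b" "0 \<le> b - a"
    using sqrt_majorant_bounds(1)[of "Suc n"] zero_le_power2[of "sqrt_majorant n - 1"]
    by (simp_all add: a_def b_def power2_diff)
  have "Z (Z x) - Y (Y x) = Z (Z x - Y x) + (Z (Y x) - Y (Y x))"
    by (simp add: Z.diff)
  also have "norm \<dots> \<le> b * norm (Z x - Y x) + (b - a) * norm (Y x)"
    by (intro norm_triangle_le add_mono Z IH)
  also have "\<dots> \<le> b * ((b - a) * norm x) + (b - a) * (a * norm x)"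
    by (intro add_mono mult_left_mono IH Y ab)
  also have "\<dots> = (b\<^sup>2 - a\<^sup>2) * norm x"
    by (simp add: algebra_simps power2_eq_square)
  finally have "norm (Z (Z x) - Y (Y x)) \<le> (b\<^sup>2 - a\<^sup>2) * norm x" .
  moreover have "sqrt_iter X (Suc (Suc n)) x - Z x = (1 / 2) *\<^sub>R (Z (Z x) - Y (Y x))"
    by (simp add: Z_def Y_def algebra_simps)
  then have "norm (sqrt_iter X (Suc (Suc n)) x - Z x) = norm (Z (Z x) - Y (Y x)) / 2"
    by simp
  moreover have "(sqrt_majorant (Suc (Suc n)) - b) * norm x = (b\<^sup>2 - a\<^sup>2) * norm x / 2"
    by (simp add: b_def a_def field_simps)
  ultimately show ?case
    unfolding Z_def[symmetric] b_def[symmetric] by linarith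
qed

lemma sqrt_iter_Cauchy:
  fixes X :: "'a::real_normed_vector \<Rightarrow> 'a"
  assumes "bounded_linear X" and X: "\<And>x. norm (X x) \<le> norm x"
  shows "Cauchy (\<lambda>n. sqrt_iter X n x)"
proof -
  have diff: "norm (sqrt_iter X (n + k) x - sqrt_iter X n x)
      \<le> (sqrt_majorant (n + k) - sqrt_majorant n) * norm x" for n k
  proof (induction k)
    case (Suc k)
    have "norm (sqrt_iter X (n + Suc k) x - sqrt_iter X n x)
        \<le> norm (sqrt_iter X (Suc (n + k)) x - sqrt_iter X (n + k) x)
          + norm (sqrt_iter X (n + k) x - sqrt_iter X n x)"
      using norm_triangle_ineq[of "sqrt_iter X (Suc (n + k)) x - sqrt_iter X (n + k) x"
          "sqrt_iter X (n + k) x - sqrt_iter X n x"] by (simp del: sqrt_iter.simps)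
    then show ?case
      using Suc sqrt_iter_step[OF assms, of "n + k" x]
      by (simp add: left_diff_distrib del: sqrt_iter.simps sqrt_majorant.simps)
  qed simp
  have "(\<lambda>n. sqrt_majorant n * norm x) = (\<lambda>n. norm x * sqrt_majorant n)" by (simp add: mult.commute)
  then have C: "Cauchy (\<lambda>n. sqrt_majorant n * norm x)"
    using bounded_linear.Cauchy[OF bounded_linear_mult_right sqrt_majorant_Cauchy] by simp
  show ?thesis
  proof (rule CauchyI')
    fix e :: real assume "0 < e"
    then obtain M where M: "\<And>m n. M \<le> m \<Longrightarrow> M \<le> n
        \<Longrightarrow> norm (sqrt_majorant m * norm x - sqrt_majorant n * norm x) < e"
      using CauchyD[OF C, of e] by blast
    have "dist (sqrt_iter X m x) (sqrt_iter X n x) < e" if "M \<le> m" "m < n" for m n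
    proof -
      have "norm (sqrt_iter X n x - sqrt_iter X m x) \<le> (sqrt_majorant n - sqrt_majorant m) * norm x"
        using diff[of m "n - m"] \<open>m < n\<close> by simp
      then show ?thesis
        using M[of n m] that by (simp add: dist_norm norm_minus_commute left_diff_distrib)
    qed
    then show "\<exists>M. \<forall>m\<ge>M. \<forall>n>m. dist (sqrt_iter X m x) (sqrt_iter X n x) < e"
      by blast
  qed
qed

definition sqrt_limit :: "('a::real_normed_vector \<Rightarrow> 'a) \<Rightarrow> 'a \<Rightarrow> 'a" where
  "sqrt_limit X x = lim (\<lambda>n. sqrt_iter X n x)"

lemma sqrt_limit_tendsto:
  fixes X :: "'a::banach \<Rightarrow> 'a"
  assumes "bounded_linear X" and "\<And>x. norm (X x) \<le> norm x"
  shows "(\<lambda>n. sqrt_iter X n x) \<longlonglongrightarrow> sqrt_limit X x"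
  unfolding sqrt_limit_def
  using Cauchy_convergent[OF sqrt_iter_Cauchy[OF assms]] by (simp add: convergent_LIMSEQ_iff)

lemma sqrt_limit_norm:
  fixes X :: "'a::banach \<Rightarrow> 'a"
  assumes "bounded_linear X" and X: "\<And>x. norm (X x) \<le> norm x"
  shows "norm (sqrt_limit X x) \<le> norm x"
proof (rule LIMSEQ_le_const2[OF tendsto_norm[OF sqrt_limit_tendsto[OF assms]]], intro exI allI impI)
  fix n
  show "norm (sqrt_iter X n x) \<le> norm x"
    using sqrt_iter_norm[OF X, of n x] mult_right_mono[OF sqrt_majorant_bounds(2)[of n], of "norm x"]
    by simp
qed

lemma sqrt_limit_bounded_linear:
  fixes X :: "'a::banach \<Rightarrow> 'a"
  assumes "bounded_linear X" and X: "\<And>x. norm (X x) \<le> norm x"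
  shows "bounded_linear (sqrt_limit X)"
proof (rule bounded_linear_intro[where K = 1])
  note lim = sqrt_limit_tendsto[OF assms]
  have Y: "linear (sqrt_iter X n)" for n
    using sqrt_iter_bounded_linear[OF assms(1)] by (rule bounded_linear.linear)
  show "sqrt_limit X (x + y) = sqrt_limit X x + sqrt_limit X y" for x y
    using tendsto_add[OF lim[of x] lim[of y]] by (intro LIMSEQ_unique[OF lim]) (simp add: linear_add[OF Y])
  show "sqrt_limit X (r *\<^sub>R x) = r *\<^sub>R sqrt_limit X x" for r x
    using tendsto_scaleR[OF tendsto_const lim[of x]]
    by (intro LIMSEQ_unique[OF lim]) (simp add: linear_scale[OF Y])
  show "norm (sqrt_limit X x) \<le> norm x * 1" for x
    using sqrt_limit_norm[OF assms] by simp
qed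

lemma sqrt_limit_fixed_point:
  fixes X :: "'a::banach \<Rightarrow> 'a"
  assumes "bounded_linear X" and X: "\<And>x. norm (X x) \<le> norm x"
  shows "2 *\<^sub>R sqrt_limit X x = X x + sqrt_limit X (sqrt_limit X x)"
proof -
  note lim = sqrt_limit_tendsto[OF assms]
  let ?Y = "sqrt_iter X" and ?L = "sqrt_limit X"
  have "norm (?Y n (?Y n x) - ?Y n (?L x)) \<le> norm (?Y n x - ?L x)" for n
  proof -
    have "?Y n (?Y n x) - ?Y n (?L x) = ?Y n (?Y n x - ?L x)"
      using sqrt_iter_bounded_linear[OF assms(1)] by (simp add: linear_simps)
    then show ?thesis
      using sqrt_iter_norm[OF X, of n "?Y n x - ?L x"]
        mult_right_mono[OF sqrt_majorant_bounds(2)[of n], of "norm (?Y n x - ?L x)"] by simp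
  qed
  moreover have "(\<lambda>n. norm (?Y n x - ?L x)) \<longlonglongrightarrow> 0"
    using lim[of x] by (simp add: LIM_zero tendsto_norm_zero)
  ultimately have "(\<lambda>n. ?Y n (?Y n x) - ?Y n (?L x)) \<longlonglongrightarrow> 0"
    by (rule Lim_null_comparison[OF always_eventually[OF allI]])
  from tendsto_add[OF this lim[of "?L x"]] have "(\<lambda>n. ?Y n (?Y n x)) \<longlonglongrightarrow> ?L (?L x)"
    by simp
  then have "(\<lambda>n. ?Y (Suc n) x) \<longlonglongrightarrow> (1 / 2) *\<^sub>R (X x + ?L (?L x))"
    unfolding sqrt_iter.simps by (intro tendsto_intros)
  then have "?L x = (1 / 2) *\<^sub>R (X x + ?L (?L x))"
    using LIMSEQ_Suc[OF lim[of x]] LIMSEQ_unique by blast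
  from arg_cong[OF this, of "\<lambda>y. 2 *\<^sub>R y"] show ?thesis by simp
qed

lemma sqrt_limit_symmetric:
  fixes X :: "'a::{real_inner, banach} \<Rightarrow> 'a"
  assumes "bounded_linear X" and X: "\<And>x. norm (X x) \<le> norm x"
    and sym: "\<And>x y. inner (X x) y = inner x (X y)"
  shows "inner (sqrt_limit X x) y = inner x (sqrt_limit X y)"
proof (rule LIMSEQ_unique)
  note lim = sqrt_limit_tendsto[OF assms(1,2)]
  have "inner (sqrt_iter X n x) y = inner x (sqrt_iter X n y)" for n x y
    by (induction n arbitrary: x y) (simp_all add: sym inner_add)
  then show "(\<lambda>n. inner (sqrt_iter X n x) y) \<longlonglongrightarrow> inner x (sqrt_limit X y)"
    using tendsto_inner[OF tendsto_const lim[of y]] by simp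
  show "(\<lambda>n. inner (sqrt_iter X n x) y) \<longlonglongrightarrow> inner (sqrt_limit X x) y"
    using tendsto_inner[OF lim[of x] tendsto_const] .
qed

lemma sqrt_limit_intertwines:
  fixes X :: "'a::banach \<Rightarrow> 'a" and X' :: "'b::banach \<Rightarrow> 'b"
  assumes "bounded_linear X" and "\<And>x. norm (X x) \<le> norm x"
    and "bounded_linear X'" and "\<And>x. norm (X' x) \<le> norm x"
    and F: "bounded_linear F" and FX: "\<And>x. F (X x) = X' (F x)"
  shows "F (sqrt_limit X x) = sqrt_limit X' (F x)"
proof (rule LIMSEQ_unique)
  interpret F: bounded_linear F by (rule F)
  have "F (sqrt_iter X n x) = sqrt_iter X' n (F x)" for n x
    by (induction n arbitrary: x) (simp_all add: F.zero F.add F.scaleR FX)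
  then show "(\<lambda>n. F (sqrt_iter X n x)) \<longlonglongrightarrow> sqrt_limit X' (F x)"
    using sqrt_limit_tendsto[OF assms(3,4)] by simp
  show "(\<lambda>n. F (sqrt_iter X n x)) \<longlonglongrightarrow> F (sqrt_limit X x)"
    by (intro F.tendsto sqrt_limit_tendsto assms)
qed

text \<open>
  \<open>c\<close> is any positive bound for the operator norm of \<open>T\<close>; keeping it as a parameter lets roots of
  different operators be compared by one and the same iteration.
\<close>

definition pos_root :: "real \<Rightarrow> ('a::real_normed_vector \<Rightarrow> 'a) \<Rightarrow> 'a \<Rightarrow> 'a" where
  "pos_root c T x = sqrt c *\<^sub>R (x - sqrt_limit (\<lambda>x. x - (1 / c) *\<^sub>R T x) x)"

lemma pos_root_iteration_ok:
  assumes "pos_sym T" and bound: "\<And>x. norm (T x) \<le> c * norm x" and "0 < c"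
  shows "bounded_linear (\<lambda>x. x - (1 / c) *\<^sub>R T x)" "norm (x - (1 / c) *\<^sub>R T x) \<le> norm x"
proof -
  show "bounded_linear (\<lambda>x. x - (1 / c) *\<^sub>R T x)"
    by (intro bounded_linear_sub bounded_linear_ident bounded_linear_const_scaleR
        pos_symD(1)[OF assms(1)])
  have "c *\<^sub>R (x - (1 / c) *\<^sub>R T x) = c *\<^sub>R x - T x"
    using \<open>0 < c\<close> by (simp add: scaleR_diff_right)
  then have "c * norm (x - (1 / c) *\<^sub>R T x) = norm (c *\<^sub>R x - T x)"
    using \<open>0 < c\<close> by (metis abs_of_pos norm_scaleR)
  also have "\<dots> \<le> c * norm x"
    using pos_sym_complement_contraction[OF assms(1) bound] \<open>0 < c\<close> by simp
  finally show "norm (x - (1 / c) *\<^sub>R T x) \<le> norm x"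
    using \<open>0 < c\<close> by simp
qed

lemma pos_root:
  fixes T :: "'a::{real_inner, banach} \<Rightarrow> 'a"
  assumes "pos_sym T" and bound: "\<And>x. norm (T x) \<le> c * norm x" and "0 < c"
  shows pos_sym_pos_root: "pos_sym (pos_root c T)"
    and pos_root_square: "pos_root c T (pos_root c T x) = T x"
proof -
  define X where "X = (\<lambda>x. x - (1 / c) *\<^sub>R T x)"
  have X: "bounded_linear X" "\<And>x. norm (X x) \<le> norm x"
    unfolding X_def by (rule pos_root_iteration_ok[OF assms])+
  have sym: "inner (X x) y = inner x (X y)" for x y
    by (simp add: X_def inner_diff pos_symD(2)[OF assms(1)])
  let ?L = "sqrt_limit X"
  note L = sqrt_limit_bounded_linear[OF X]
  interpret L: bounded_linear ?L by (rule L)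
  have root: "pos_root c T = (\<lambda>x. sqrt c *\<^sub>R (x - ?L x))"
    by (rule ext) (simp add: pos_root_def X_def)
  have "0 \<le> inner (x - ?L x) x" for x
  proof -
    have "inner (?L x) x \<le> norm (?L x) * norm x" by (rule norm_cauchy_schwarz)
    also have "\<dots> \<le> norm x * norm x" by (intro mult_right_mono sqrt_limit_norm[OF X]) simp
    finally show ?thesis by (simp add: inner_diff_left dot_square_norm power2_eq_square)
  qed
  moreover have "bounded_linear (\<lambda>x. sqrt c *\<^sub>R (x - ?L x))"
    by (intro bounded_linear_sub bounded_linear_ident bounded_linear_const_scaleR L)
  ultimately show "pos_sym (pos_root c T)"
    unfolding pos_sym_def root using \<open>0 < c\<close> sqrt_limit_symmetric[OF X sym]
    by (simp add: inner_diff)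
  have "pos_root c T (pos_root c T x) = c *\<^sub>R (x - 2 *\<^sub>R ?L x + ?L (?L x))"
    using \<open>0 < c\<close> by (simp add: root L.diff L.scaleR algebra_simps scaleR_2)
  also have "x - 2 *\<^sub>R ?L x + ?L (?L x) = x - X x"
    by (simp add: sqrt_limit_fixed_point[OF X])
  also have "c *\<^sub>R (x - X x) = T x"
    using \<open>0 < c\<close> by (simp add: X_def)
  finally show "pos_root c T (pos_root c T x) = T x" .
qed

lemma pos_root_intertwines:
  fixes T :: "'a::{real_inner, banach} \<Rightarrow> 'a" and T' :: "'b::{real_inner, banach} \<Rightarrow> 'b"
  assumes "pos_sym T" and "\<And>x. norm (T x) \<le> c * norm x"
    and "pos_sym T'" and "\<And>x. norm (T' x) \<le> c * norm x" and "0 < c"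
    and F: "bounded_linear F" and FT: "\<And>x. F (T x) = T' (F x)"
  shows "F (pos_root c T x) = pos_root c T' (F x)"
proof -
  interpret F: bounded_linear F by (rule F)
  have "F (sqrt_limit (\<lambda>x. x - (1 / c) *\<^sub>R T x) x) = sqrt_limit (\<lambda>x. x - (1 / c) *\<^sub>R T' x) (F x)"
  proof (rule sqrt_limit_intertwines)
    show "bounded_linear (\<lambda>x. x - (1 / c) *\<^sub>R T x)" "norm (x - (1 / c) *\<^sub>R T x) \<le> norm x" for x
      by (rule pos_root_iteration_ok[OF assms(1,2) \<open>0 < c\<close>])+
    show "bounded_linear (\<lambda>x. x - (1 / c) *\<^sub>R T' x)" "norm (x - (1 / c) *\<^sub>R T' x) \<le> norm x" for x
      by (rule pos_root_iteration_ok[OF assms(3,4) \<open>0 < c\<close>])+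
  qed (simp_all add: F F.diff F.scaleR FT)
  then show ?thesis
    by (simp add: pos_root_def F.diff F.scaleR)
qed

text \<open>
  Any positive \<open>S\<close> with \<open>S\<^sup>2 = T\<close> commutes with \<open>T\<close>, hence with the constructed root \<open>R\<close>.  So
  \<open>(S + R) (S - R) = 0\<close>, and positivity forces both \<open>S\<close> and \<open>R\<close> to vanish on the range of \<open>S - R\<close>.
\<close>

lemma pos_root_unique:
  fixes S :: "'a::{real_inner, banach} \<Rightarrow> 'a"
  assumes S: "pos_sym S" and T: "pos_sym T" and SS: "\<And>x. S (S x) = T x"
    and bound: "\<And>x. norm (T x) \<le> c * norm x" and "0 < c"
  shows "S x = pos_root c T x"
proof -
  define R where "R = pos_root c T"
  have R: "pos_sym R" and RR: "\<And>x. R (R x) = T x"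
    unfolding R_def using pos_root[OF T bound \<open>0 < c\<close>] by auto
  interpret S: bounded_linear S using S by (rule pos_symD)
  interpret R: bounded_linear R using R by (rule pos_symD)
  have comm: "S (R x) = R (S x)" for x
    unfolding R_def
    by (rule pos_root_intertwines[OF T bound T bound \<open>0 < c\<close> S.bounded_linear_axioms])
      (simp add: SS[symmetric])
  define y where "y = S x - R x"
  have "S y + R y = 0"
    by (simp add: y_def S.diff R.diff SS RR comm)
  then have "inner (S y) y + inner (R y) y = 0"
    by (simp add: inner_add_left[symmetric])
  then have 0: "inner (S y) y = 0" "inner (R y) y = 0"
    using pos_symD(3)[OF S, of y] pos_symD(3)[OF R, of y] by linarith+
  have "P y = 0" if P: "pos_sym P" "inner (P y) y = 0" for P
    using pos_sym_Cauchy_Schwarz[OF P(1), of y "P y"] P(2) by simp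
  then have "S y = 0" "R y = 0" using S R 0 by auto
  then have "inner y y = 0"
    using pos_symD(2)[OF S, of x y] pos_symD(2)[OF R, of x y]
    by (simp add: y_def[symmetric] inner_diff_left[of "S x" "R x" y, folded y_def])
  then show ?thesis by (simp add: y_def R_def)
qed

text \<open>
  The roots of \<open>P\<^sup>2\<close> and \<open>Q\<^sup>2\<close> are \<open>P\<close> and \<open>Q\<close> by uniqueness, and for a common bound \<open>c\<close> they come from
  the same iteration, which respects \<open>F\<close> at each step.
\<close>

lemma pos_sym_intertwines:
  fixes P :: "'a::{real_inner, banach} \<Rightarrow> 'a" and Q :: "'b::{real_inner, banach} \<Rightarrow> 'b"
  assumes P: "pos_sym P" and Q: "pos_sym Q" and F: "bounded_linear F"
    and FPP: "\<And>x. F (P (P x)) = Q (Q (F x))"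
  shows "F (P x) = Q (F x)"
proof -
  have sq: "pos_sym (\<lambda>x. S (S x))" if "pos_sym S" for S :: "'c::{real_inner, banach} \<Rightarrow> 'c"
    unfolding pos_sym_def
  proof (intro conjI allI)
    show "bounded_linear (\<lambda>x. S (S x))"
      using pos_symD(1)[OF that] by (intro bounded_linear_compose[of S S])
    show sym: "inner (S (S x)) y = inner x (S (S y))" for x y
      by (simp only: pos_symD(2)[OF that])
    show "0 \<le> inner (S (S x)) x" for x
      by (simp only: pos_symD(2)[OF that, of "S x" x] inner_ge_zero)
  qed
  have bounded: "\<exists>c>0. \<forall>x. norm (S x) \<le> norm x * c" if "pos_sym S"
    for S :: "'c::{real_inner, banach} \<Rightarrow> 'c"
    using bounded_linear.pos_bounded[OF pos_symD(1)[OF that]] by blast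
  obtain a where a: "0 < a" "\<And>x. norm (P (P x)) \<le> norm x * a"
    using bounded[OF sq[OF P]] by blast
  obtain b where b: "0 < b" "\<And>x. norm (Q (Q x)) \<le> norm x * b"
    using bounded[OF sq[OF Q]] by blast
  define c where "c = max a b"
  have c: "0 < c" using a by (simp add: c_def)
  have Pc: "norm (P (P x)) \<le> c * norm x" for x
    using a(2)[of x] mult_right_mono[of a c "norm x"] by (simp add: c_def mult.commute)
  have Qc: "norm (Q (Q x)) \<le> c * norm x" for x
    using b(2)[of x] mult_right_mono[of b c "norm x"] by (simp add: c_def mult.commute)
  have "F (pos_root c (\<lambda>x. P (P x)) x) = pos_root c (\<lambda>x. Q (Q x)) (F x)"
    by (rule pos_root_intertwines) (use sq P Q Pc Qc c F FPP in auto)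
  then show ?thesis
    by (simp only: pos_root_unique[OF P sq[OF P] HOL.refl Pc c, symmetric]
        pos_root_unique[OF Q sq[OF Q] HOL.refl Qc c, symmetric])
qed


section \<open>The mixed Schwarz inequality and a norm bound\<close>

lemma pos_sym_add_scaleR:
  assumes "pos_sym P" and "0 \<le> e"
  shows "pos_sym (\<lambda>x. P x + e *\<^sub>R x)"
  unfolding pos_sym_def
proof (intro conjI allI)
  show "bounded_linear (\<lambda>x. P x + e *\<^sub>R x)"
    by (intro bounded_linear_add pos_symD(1)[OF assms(1)] bounded_linear_const_scaleR
        bounded_linear_ident)
  show "inner (P x + e *\<^sub>R x) y = inner x (P y + e *\<^sub>R y)" for x y
    by (simp add: inner_add pos_symD(2)[OF assms(1)])
  show "0 \<le> inner (P x + e *\<^sub>R x) x" for x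
    using pos_symD(3)[OF assms(1), of x] \<open>0 \<le> e\<close> by (simp add: inner_add)
qed

text \<open>The solution of \<open>P z + e z = x\<close> is the fixed point of a map with contraction factor \<open>c / (c + e)\<close>.\<close>

lemma pos_sym_add_scaleR_surj:
  fixes P :: "'a::{real_inner, banach} \<Rightarrow> 'a"
  assumes P: "pos_sym P" and e: "0 < e"
  shows "\<exists>z. P z + e *\<^sub>R z = x"
proof -
  interpret P: bounded_linear P using P by (rule pos_symD)
  obtain c where c: "0 < c" and c_bound: "\<And>x. norm (P x) \<le> norm x * c"
    using P.pos_bounded by blast
  define f where "f z = (1 / (c + e)) *\<^sub>R (c *\<^sub>R z - P z + x)" for z
  have "dist (f z) (f w) \<le> c / (c + e) * dist z w" for z w
  proof -
    have "f z - f w = (1 / (c + e)) *\<^sub>R (c *\<^sub>R (z - w) - P (z - w))"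
      by (simp add: f_def P.diff algebra_simps)
    moreover have "norm (c *\<^sub>R (z - w) - P (z - w)) \<le> c * norm (z - w)"
      by (rule pos_sym_complement_contraction[OF P]) (use c c_bound in \<open>simp_all add: mult.commute\<close>)
    ultimately show ?thesis
      using c e by (simp add: dist_norm divide_right_mono)
  qed
  then have "\<exists>!z. f z = z"
    using c e by (intro banach_fix_type[of "c / (c + e)"]) auto
  then obtain z where "f z = z" by blast
  then have "(c + e) *\<^sub>R z = (c + e) *\<^sub>R f z" by simp
  also have "\<dots> = c *\<^sub>R z - P z + x"
    using c e by (simp add: f_def)
  finally have "P z + e *\<^sub>R z = x" by (simp add: algebra_simps)
  then show ?thesis by blast
qed

text \<open>
  For \<open>P = \<bar>T\<bar>\<close> and \<open>Q = \<bar>T\<^sup>*\<bar>\<close>.  The intertwining relation \<open>T P = Q T\<close> moves the Cauchy-Schwarz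
  inequality for the form of \<open>Q + e\<close> to the vector \<open>z = (P + e)\<^sup>-\<^sup>1 x\<close>, and \<open>P\<^sup>2 (P + e)\<^sup>-\<^sup>1 \<le> P\<close>.
  The shift by \<open>e > 0\<close> replaces the polar decomposition of \<open>T\<close>; it disappears in the limit.
\<close>

lemma mixed_Schwarz:
  fixes T :: "'a::{real_inner, banach} \<Rightarrow> 'b::{real_inner, banach}"
  assumes T: "bounded_linear T" and adj: "\<And>x y. inner (T x) y = inner x (T' y)"
    and P: "pos_sym P" and PP: "\<And>x. P (P x) = T' (T x)"
    and Q: "pos_sym Q" and QQ: "\<And>y. Q (Q y) = T (T' y)"
  shows "(inner (T x) y)\<^sup>2 \<le> inner (P x) x * inner (Q y) y"
proof -
  interpret T: bounded_linear T by (rule T)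
  interpret P: bounded_linear P using P by (rule pos_symD)
  have TP: "T (P x) = Q (T x)" for x
    by (rule pos_sym_intertwines[OF P Q T]) (simp add: PP QQ)
  have shifted: "(inner (T x) y)\<^sup>2 \<le> inner (P x) x * (inner (Q y) y + e * inner y y)" if e: "0 < e" for e
  proof -
    define Qe where "Qe = (\<lambda>x. Q x + e *\<^sub>R x)"
    have Qe: "pos_sym Qe"
      unfolding Qe_def using Q e by (intro pos_sym_add_scaleR) simp_all
    obtain z where z: "P z + e *\<^sub>R z = x"
      using pos_sym_add_scaleR_surj[OF P e] by blast
    have Tx: "T x = Qe (T z)"
      by (simp add: z[symmetric] Qe_def T.add T.scaleR TP)
    have "inner (T x) (T z) = inner x (P (P z))"
      by (simp add: adj PP)
    also have "\<dots> = inner (P x) (P z)"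
      by (simp add: pos_symD(2)[OF P])
    also have "\<dots> \<le> inner (P x) x"
    proof -
      have "x - P z = e *\<^sub>R z" using z by (simp add: algebra_simps)
      then have "inner (P x) x - inner (P x) (P z) = e * inner (P x) z"
        by (metis inner_diff_right inner_scaleR_right)
      also have "inner (P x) z = inner x (P z)"
        by (rule pos_symD(2)[OF P])
      also have "\<dots> = inner (P z) (P z) + e * inner (P z) z"
        by (simp add: z[symmetric] inner_add inner_commute)
      finally show ?thesis
        using e pos_symD(3)[OF P, of z] by (smt (verit) inner_ge_zero mult_nonneg_nonneg)
    qed
    finally have bound: "inner (T x) (T z) \<le> inner (P x) x" .
    have "(inner (T x) y)\<^sup>2 \<le> inner (T x) (T z) * inner (Qe y) y"
      using pos_sym_Cauchy_Schwarz[OF Qe, of "T z" y] by (simp add: Tx)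
    also have "\<dots> \<le> inner (P x) x * inner (Qe y) y"
      using bound pos_symD(3)[OF Qe] by (rule mult_right_mono)
    finally show ?thesis by (simp add: Qe_def inner_add)
  qed
  have lim: "(\<lambda>n. inner (P x) x * (inner (Q y) y + inverse (real (Suc n)) * inner y y))
      \<longlonglongrightarrow> inner (P x) x * (inner (Q y) y + 0 * inner y y)"
    by (intro tendsto_intros LIMSEQ_inverse_real_of_nat)
  have "(inner (T x) y)\<^sup>2 \<le> inner (P x) x * (inner (Q y) y + 0 * inner y y)"
    by (rule LIMSEQ_le_const[OF lim]) (intro exI allI impI shifted, simp)
  then show ?thesis by simp
qed

text \<open>
  With \<open>u = T x\<close> and \<open>v = T\<^sup>* x\<close>, the cross terms of \<open>\<parallel>T\<^sup>* u + T v\<parallel>\<^sup>2\<close> are \<open>2 \<langle>u, T\<^sup>2 v\<rangle>\<close>, while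
  \<open>\<parallel>u\<parallel>\<^sup>2 + \<parallel>v\<parallel>\<^sup>2\<close> is the form of \<open>T\<^sup>* T + T T\<^sup>*\<close> at \<open>x\<close>.
\<close>

lemma norm_adjoint_products_sum_le:
  fixes T :: "'a::real_inner \<Rightarrow> 'a"
  assumes adj: "\<And>x y. inner (T x) y = inner x (T' y)"
    and T: "\<And>x. norm (T x) \<le> a * norm x" and T': "\<And>x. norm (T' x) \<le> a * norm x"
    and TT: "\<And>x. norm (T (T x)) \<le> b * norm x" and ab: "0 \<le> a" "0 \<le> b"
  shows "norm (T' (T x) + T (T' x)) \<le> (a\<^sup>2 + b) * norm x"
proof -
  define u v w where "u = T x" and "v = T' x" and "w = T' u + T v"
  have form: "(norm u)\<^sup>2 + (norm v)\<^sup>2 \<le> norm w * norm x"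
  proof -
    have "(norm u)\<^sup>2 + (norm v)\<^sup>2 = inner w x"
      using adj[of x "T x"] adj[of "T' x" x]
      by (simp add: power2_norm_eq_inner u_def v_def w_def inner_add inner_commute)
    then show ?thesis by (simp add: norm_cauchy_schwarz)
  qed
  have cross: "inner (T' u) (T v) \<le> b * (norm u * norm v)"
  proof -
    have "inner (T' u) (T v) = inner (T (T v)) u"
      by (subst inner_commute) (simp only: adj)
    also have "\<dots> \<le> norm (T (T v)) * norm u" by (rule norm_cauchy_schwarz)
    also have "\<dots> \<le> (b * norm v) * norm u" by (intro mult_right_mono TT) simp
    finally show ?thesis by (simp add: mult_ac)
  qed
  have "(norm w)\<^sup>2 = (norm (T' u))\<^sup>2 + (norm (T v))\<^sup>2 + 2 * inner (T' u) (T v)"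
    by (simp add: w_def power2_norm_eq_inner inner_add inner_commute)
  also have "\<dots> \<le> (a * norm u)\<^sup>2 + (a * norm v)\<^sup>2 + 2 * (b * (norm u * norm v))"
    using cross power_mono[OF T'[of u], of 2] power_mono[OF T[of v], of 2] by simp
  also have "2 * (b * (norm u * norm v)) \<le> b * ((norm u)\<^sup>2 + (norm v)\<^sup>2)"
  proof -
    have "2 * (norm u * norm v) \<le> (norm u)\<^sup>2 + (norm v)\<^sup>2"
      using zero_le_power2[of "norm u - norm v"] by (simp add: power2_diff)
    from mult_left_mono[OF this \<open>0 \<le> b\<close>] show ?thesis by simp
  qed
  also have "(a * norm u)\<^sup>2 + (a * norm v)\<^sup>2 + b * ((norm u)\<^sup>2 + (norm v)\<^sup>2)
      = (a\<^sup>2 + b) * ((norm u)\<^sup>2 + (norm v)\<^sup>2)"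
    by (simp add: power_mult_distrib algebra_simps)
  also have "\<dots> \<le> (a\<^sup>2 + b) * (norm w * norm x)"
    using form ab by (intro mult_left_mono) simp_all
  finally have "norm w * norm w \<le> ((a\<^sup>2 + b) * norm x) * norm w"
    by (simp add: power2_eq_square mult_ac)
  then have "norm w \<le> (a\<^sup>2 + b) * norm x"
    using ab by (cases "w = 0") (simp_all add: mult_le_cancel_right)
  then show ?thesis by (simp add: u_def v_def w_def)
qed


section \<open>Adjoints and absolute values on complex Hilbert spaces\<close>

lemma bounded_clinearD:
  assumes "bounded_clinear T"
  shows "bounded_linear T" "T (a *\<^sub>C x) = a *\<^sub>C T x"
  using assms by (auto simp: bounded_clinear_def)

lemma bounded_clinear_compose:
  "bounded_clinear S \<Longrightarrow> bounded_clinear T \<Longrightarrow> bounded_clinear (S \<circ> T)"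
  unfolding bounded_clinear_def comp_def by (auto intro: bounded_linear_compose)

lemma bounded_linear_scaleC: "bounded_linear (\<lambda>x :: 'a::complex_inner. a *\<^sub>C x)"
  by (rule bounded_linear_intro[of _ "cmod a"])
    (simp_all add: scaleC_add_right scaleR_eq_scaleC scaleC_scaleC norm_scaleC mult.commute)

lemma eq_if_cinner_eq:
  fixes x y :: "'a::complex_inner"
  assumes "\<And>z. cinner z x = cinner z y"
  shows "x = y"
  by (rule eq_if_inner_eq) (simp add: inner_eq_Re_cinner assms)

text \<open>
  Only the real parts of the two forms need to be compared, because
  \<open>Im \<langle>x, y\<rangle> = Re \<langle>- i x, y\<rangle>\<close>.
\<close>

lemma cinner_adjointI:
  fixes T :: "'a::complex_inner \<Rightarrow> 'b::complex_inner"
  assumes T: "bounded_clinear T" and adj: "\<And>x y. inner (T x) y = inner x (S y)"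
  shows "cinner (T x) y = cinner x (S y)"
proof (rule complex_eqI)
  show "Re (cinner (T x) y) = Re (cinner x (S y))"
    using adj by (simp add: inner_eq_Re_cinner)
  have Im: "Im (cinner u v) = inner ((- \<i>) *\<^sub>C u) v" for u v :: "'c::complex_inner"
    by (simp add: inner_eq_Re_cinner cinner_scaleC_left)
  have "inner ((- \<i>) *\<^sub>C T x) y = inner (T ((- \<i>) *\<^sub>C x)) y"
    by (simp only: bounded_clinearD(2)[OF T])
  also have "\<dots> = inner ((- \<i>) *\<^sub>C x) (S y)"
    by (rule adj)
  finally show "Im (cinner (T x) y) = Im (cinner x (S y))"
    by (simp only: Im)
qed

lemma adj_eqI:
  assumes "bounded_clinear S" and "\<And>x y. cinner (T x) y = cinner x (S y)"
  shows "adj T = S"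
  unfolding adj_def
proof (rule the_equality)
  fix S' assume "bounded_clinear S' \<and> (\<forall>x y. cinner (T x) y = cinner x (S' y))"
  then have "cinner x (S' y) = cinner x (S y)" for x y
    using assms(2) by metis
  then show "S' = S"
    by (intro ext eq_if_cinner_eq)
qed (use assms in simp)

lemma adj:
  assumes T: "bounded_clinear T"
  shows bounded_clinear_adj: "bounded_clinear (adj T)"
    and cinner_adj: "cinner (T x) y = cinner x (adj T y)"
proof -
  obtain S where S: "bounded_linear S" "\<And>x y. inner (T x) y = inner x (S y)"
    using real_adjoint_exists[OF bounded_clinearD(1)[OF T]] by blast
  have cinner: "cinner (T x) y = cinner x (S y)" for x y
    by (rule cinner_adjointI[OF T S(2)])
  have "S (a *\<^sub>C y) = a *\<^sub>C S y" for a y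
    by (rule eq_if_cinner_eq) (simp add: cinner[symmetric] cinner_scaleC_right)
  then have "bounded_clinear S"
    using S(1) by (simp add: bounded_clinear_def)
  then have "adj T = S"
    using cinner by (rule adj_eqI)
  then show "bounded_clinear (adj T)" "cinner (T x) y = cinner x (adj T y)"
    using \<open>bounded_clinear S\<close> cinner by simp_all
qed

lemma inner_adj: "bounded_clinear T \<Longrightarrow> inner (T x) y = inner x (adj T y)"
  by (simp add: inner_eq_Re_cinner cinner_adj)

lemma cinner_adj_left: "bounded_clinear T \<Longrightarrow> cinner (adj T x) y = cinner x (T y)"
  by (metis cinner_adj cinner_commute)

lemma adj_adj: "bounded_clinear T \<Longrightarrow> adj (adj T) = T"
  by (intro adj_eqI cinner_adj_left)

lemma adj_compose:
  "bounded_clinear S \<Longrightarrow> bounded_clinear T \<Longrightarrow> adj (S \<circ> T) = adj T \<circ> adj S"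
  by (intro adj_eqI bounded_clinear_compose bounded_clinear_adj) (simp_all add: cinner_adj)

lemma norm_adj_le:
  assumes T: "bounded_clinear T" and bound: "\<And>x. norm (T x) \<le> c * norm x" and "0 \<le> c"
  shows "norm (adj T y) \<le> c * norm y"
proof (cases "adj T y = 0")
  case False
  have "norm (adj T y) * norm (adj T y) = inner (T (adj T y)) y"
    by (simp add: inner_adj[OF T] dot_square_norm power2_eq_square)
  also have "\<dots> \<le> norm (T (adj T y)) * norm y"
    by (rule norm_cauchy_schwarz)
  also have "\<dots> \<le> (c * norm (adj T y)) * norm y"
    by (intro mult_right_mono bound) simp
  finally have "norm (adj T y) * norm (adj T y) \<le> (c * norm y) * norm (adj T y)"
    by (simp add: mult_ac)
  then show ?thesis using False by (simp add: mult_le_cancel_right)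
qed (use \<open>0 \<le> c\<close> in simp)

text \<open>Over the complex numbers a real quadratic form comes from a symmetric operator, by polarization.\<close>

lemma positive_op_iff: "positive_op T \<longleftrightarrow> bounded_clinear T \<and> pos_sym T"
proof
  assume T: "positive_op T"
  then have lin: "bounded_clinear T" and Im: "\<And>x. Im (cinner (T x) x) = 0"
    and pos: "\<And>x. 0 \<le> inner (T x) x"
    by (auto simp: positive_op_def complex_is_Real_iff inner_eq_Re_cinner)
  interpret T: bounded_linear T using lin by (rule bounded_clinearD)
  have skew: "Im (cinner (T x) y) + Im (cinner (T y) x) = 0" for x y
    using Im[of "x + y"] Im[of x] Im[of y] by (simp add: T.add cinner_add_left cinner_add_right)
  have "inner (T x) y = inner x (T y)" for x y
    using skew[of "\<i> *\<^sub>C x" y]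
    by (simp add: bounded_clinearD(2)[OF lin] cinner_scaleC_left cinner_scaleC_right
        inner_eq_Re_cinner cinner_commute[of x])
  then show "bounded_clinear T \<and> pos_sym T"
    using lin pos by (simp add: pos_sym_def T.bounded_linear_axioms)
next
  assume T: "bounded_clinear T \<and> pos_sym T"
  then have sym: "cinner (T x) y = cinner x (T y)" for x y
    by (intro cinner_adjointI) (simp_all add: pos_sym_def)
  have "Im (cinner (T x) x) = 0" for x
    using arg_cong[OF cinner_commute[of x "T x"], of Im] sym[of x x] by simp
  then show "positive_op T"
    using T by (auto simp: positive_op_def pos_sym_def complex_is_Real_iff inner_eq_Re_cinner)
qed

lemma positive_opD:
  assumes "positive_op T"
  shows "bounded_clinear T" "pos_sym T" "cinner (T x) y = cinner x (T y)" "adj T = T"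
proof -
  show T: "bounded_clinear T" "pos_sym T"
    using assms by (simp_all add: positive_op_iff)
  show sym: "cinner (T x) y = cinner x (T y)" for x y
    using T by (intro cinner_adjointI) (simp_all add: pos_sym_def)
  show "adj T = T"
    by (rule adj_eqI[OF T(1) sym])
qed

text \<open>The real square root is complex linear because it commutes with multiplication by scalars.\<close>

lemma sqrt_op:
  assumes T: "positive_op T"
  shows positive_op_sqrt_op: "positive_op (sqrt_op T)"
    and sqrt_op_square: "sqrt_op T (sqrt_op T x) = T x"
proof -
  note pos = positive_opD(2)[OF T] and lin = positive_opD(1)[OF T]
  obtain c where c: "0 < c" and "\<And>x. norm (T x) \<le> norm x * c"
    using bounded_linear.pos_bounded[OF bounded_clinearD(1)[OF lin]] by blast
  then have bound: "norm (T x) \<le> c * norm x" for x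
    by (simp add: mult.commute)
  define R where "R = pos_root c T"
  have R: "pos_sym R" and RR: "R (R x) = T x" for x
    unfolding R_def by (rule pos_root[OF pos bound c])+
  have "a *\<^sub>C R x = R (a *\<^sub>C x)" for a x
    unfolding R_def
    by (rule pos_root_intertwines[OF pos bound pos bound c bounded_linear_scaleC])
      (simp add: bounded_clinearD(2)[OF lin])
  then have R_pos: "positive_op R"
    using R by (simp add: positive_op_iff bounded_clinear_def pos_symD)
  have "sqrt_op T = R"
    unfolding sqrt_op_def
  proof (rule the_equality)
    show "positive_op R \<and> R \<circ> R = T"
      using R_pos by (simp add: RR comp_def)
    fix S assume S: "positive_op S \<and> S \<circ> S = T"
    then have "S x = R x" for x
      unfolding R_def
      by (intro pos_root_unique[OF _ pos _ bound c]) (auto simp: positive_op_iff)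
    then show "S = R" by (rule ext)
  qed
  then show "positive_op (sqrt_op T)" "sqrt_op T (sqrt_op T x) = T x"
    using R_pos RR by simp_all
qed

lemma positive_op_adj_compose:
  assumes "bounded_clinear T"
  shows "positive_op (adj T \<circ> T)"
  unfolding positive_op_def
  using assms by (simp add: bounded_clinear_compose bounded_clinear_adj cinner_adj_left cinner_self)

lemma positive_op_abs_op: "bounded_clinear T \<Longrightarrow> positive_op (abs_op T)"
  unfolding abs_op_def by (intro positive_op_sqrt_op positive_op_adj_compose)

lemma abs_op_square: "bounded_clinear T \<Longrightarrow> abs_op T (abs_op T x) = adj T (T x)"
  unfolding abs_op_def by (simp add: sqrt_op_square positive_op_adj_compose)

lemma norm_abs_op:
  assumes "bounded_clinear T"
  shows "norm (abs_op T x) = norm (T x)"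
proof -
  have "inner (abs_op T x) (abs_op T x) = inner x (abs_op T (abs_op T x))"
    by (rule pos_symD(2)[OF positive_opD(2)[OF positive_op_abs_op[OF assms]]])
  also have "\<dots> = inner (T x) (T x)"
    by (simp add: abs_op_square inner_adj assms)
  finally show ?thesis by (simp add: norm_eq_sqrt_inner)
qed

text \<open>
  Since \<open>\<parallel>\<bar>T\<bar> y\<parallel> = \<parallel>T y\<parallel>\<close>, both factors can be traded for \<open>T\<close>: the left one at once, the right one
  after passing to the adjoint \<open>\<bar>T\<^sup>*\<bar> T\<^sup>*\<close> of \<open>T \<bar>T\<^sup>*\<bar>\<close>.
\<close>

lemma norm_abs_op_abs_op_adj_le:
  assumes T: "bounded_clinear T" and bound: "\<And>x. norm (T (T x)) \<le> b * norm x" and "0 \<le> b"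
  shows "norm (abs_op T (abs_op (adj T) x)) \<le> b * norm x"
proof -
  let ?Q = "abs_op (adj T)"
  have T': "bounded_clinear (adj T)" using T by (rule bounded_clinear_adj)
  note Q = positive_op_abs_op[OF T']
  have "adj (T \<circ> ?Q) = ?Q \<circ> adj T"
    by (simp add: adj_compose T positive_opD[OF Q])
  then have adj_eq: "adj (?Q \<circ> adj T) = T \<circ> ?Q"
    by (metis adj_adj T bounded_clinear_compose positive_opD(1)[OF Q])
  have "norm (adj (T \<circ> T) x) \<le> b * norm x" for x
    by (rule norm_adj_le) (use T bound \<open>0 \<le> b\<close> in \<open>simp_all add: bounded_clinear_compose\<close>)
  then have "norm ((?Q \<circ> adj T) x) \<le> b * norm x" for x
    by (simp add: norm_abs_op T' adj_compose T)
  then have "norm (adj (?Q \<circ> adj T) x) \<le> b * norm x"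
    using \<open>0 \<le> b\<close> by (intro norm_adj_le bounded_clinear_compose T' positive_opD(1)[OF Q]) auto
  then show ?thesis
    by (simp add: adj_eq norm_abs_op T)
qed


section \<open>Tensor products of operators\<close>

definition tens_map :: "('a::complex_inner \<Rightarrow> 'c::complex_inner) \<Rightarrow> ('b::complex_inner \<Rightarrow> 'd::complex_inner)
    \<Rightarrow> ('a \<times> 'b) multiset \<Rightarrow> ('c \<times> 'd) multiset" where
  "tens_map A B s = image_mset (\<lambda>p. (A (fst p), B (snd p))) s"

lemma tens_map_cong:
  assumes A: "bounded_clinear A" and B: "bounded_clinear B"
  shows "tens_eq s t \<Longrightarrow> tens_eq (tens_map A B s) (tens_map A B t)"
proof (induction rule: tens_eq.induct)
  case (sym s t)
  then show ?case by (blast intro: tens_eq.sym)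
next
  case (trans s t u)
  then show ?case by (blast intro: tens_eq.trans)
next
  interpret A: bounded_linear A using A by (rule bounded_clinearD)
  interpret B: bounded_linear B using B by (rule bounded_clinearD)
  {
    case (add_left x x' y)
    show ?case using tens_eq.add_left[of "A x" "A x'" "B y"] by (simp add: tens_map_def A.add)
  next
    case (add_right x y y')
    show ?case using tens_eq.add_right[of "A x" "B y" "B y'"] by (simp add: tens_map_def B.add)
  next
    case (scale a x y)
    show ?case using tens_eq.scale[of a "A x" "B y"]
      by (simp add: tens_map_def bounded_clinearD(2)[OF A] bounded_clinearD(2)[OF B])
  next
    case (zero y)
    show ?case using tens_eq.zero[of "B y"] by (simp add: tens_map_def A.zero)
  }
qed (simp_all add: tens_map_def tens_eq.refl tens_eq.plus)

lemma tens_map_scale: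
  "bounded_clinear A \<Longrightarrow> tens_map A B (tens_scale a s) = tens_scale a (tens_map A B s)"
  by (simp add: tens_map_def tens_scale_def multiset.map_comp comp_def bounded_clinearD(2))

lemma tens_inner_tens_map:
  "tens_inner (tens_map A B s) (tens_map A B t)
    = (\<Sum>p\<in>#s. \<Sum>q\<in>#t. cinner (A (fst p)) (A (fst q)) * cinner (B (snd p)) (B (snd q)))"
  by (simp add: tens_map_def tens_inner_def multiset.map_comp comp_def)

text \<open>A square root of \<open>c\<^sup>2 - A\<^sup>* A\<close>.\<close>

lemma complementary_operator_exists:
  fixes A :: "'a::chilbert_space \<Rightarrow> 'a"
  assumes A: "bounded_clinear A" and bound: "\<And>x. norm (A x) \<le> c * norm x"
  shows "\<exists>R :: 'a \<Rightarrow> 'a. bounded_clinear R \<and>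
    (\<forall>x y. cinner (A x) (A y) + cinner (R x) (R y) = (complex_of_real c)\<^sup>2 * cinner x y)"
proof -
  define D where "D x = complex_of_real (c\<^sup>2) *\<^sub>C x - adj A (A x)" for x
  note A' = bounded_clinear_adj[OF A]
  have "bounded_linear (\<lambda>x. complex_of_real (c\<^sup>2) *\<^sub>C x - adj A (A x))"
    using bounded_linear_compose[OF bounded_clinearD(1)[OF A'] bounded_clinearD(1)[OF A]]
    by (intro bounded_linear_sub bounded_linear_scaleC)
  moreover have "D (a *\<^sub>C x) = a *\<^sub>C D x" for a x
    by (simp add: D_def bounded_clinearD(2)[OF A] bounded_clinearD(2)[OF A'] scaleC_scaleC mult.commute
        linear_diff[OF bounded_linear.linear[OF bounded_linear_scaleC]])
  ultimately have D: "bounded_clinear D"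
    by (simp add: bounded_clinear_def D_def[abs_def])
  have form: "cinner (D x) y = (complex_of_real c)\<^sup>2 * cinner x y - cinner (A x) (A y)" for x y
    by (simp add: D_def cinner_diff_left cinner_scaleC_left cinner_adj_left[OF A])
  have "(norm (A x))\<^sup>2 \<le> c\<^sup>2 * (norm x)\<^sup>2" for x
    using power_mono[OF bound[of x], of 2] by (simp add: power_mult_distrib)
  moreover have "cinner (D x) x = complex_of_real (c\<^sup>2 * (norm x)\<^sup>2 - (norm (A x))\<^sup>2)" for x
    by (simp add: form cinner_self)
  ultimately have D_pos: "positive_op D"
    unfolding positive_op_def using D by simp
  let ?R = "sqrt_op D"
  have R: "positive_op ?R" using D_pos by (rule positive_op_sqrt_op)
  have "cinner (A x) (A y) + cinner (?R x) (?R y) = (complex_of_real c)\<^sup>2 * cinner x y" for x y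
    using positive_opD(3)[OF R, of "?R x" y, symmetric] by (simp add: sqrt_op_square[OF D_pos] form)
  then show ?thesis
    using positive_opD(1)[OF R] by blast
qed

text \<open>
  With \<open>A\<^sup>* A + R\<^sup>* R = c\<^sup>2\<close> and \<open>B\<^sup>* B + S\<^sup>* S = d\<^sup>2\<close>, the operator \<open>c\<^sup>2 d\<^sup>2 - A\<^sup>* A \<otimes> B\<^sup>* B\<close> is
  \<open>R\<^sup>* R \<otimes> d\<^sup>2 + A\<^sup>* A \<otimes> S\<^sup>* S\<close>, a sum of squares.
\<close>

lemma tens_inner_tens_map_le:
  fixes A :: "'a::chilbert_space \<Rightarrow> 'a" and B :: "'b::chilbert_space \<Rightarrow> 'b"
  assumes A: "bounded_clinear A" and A_bound: "\<And>x. norm (A x) \<le> c * norm x"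
    and B: "bounded_clinear B" and B_bound: "\<And>y. norm (B y) \<le> d * norm y"
  shows "Re (tens_inner (tens_map A B s) (tens_map A B s)) \<le> (c * d)\<^sup>2 * Re (tens_inner s s)"
proof -
  obtain R :: "'a \<Rightarrow> 'a" where R: "\<And>x y. cinner (A x) (A y) + cinner (R x) (R y) = (complex_of_real c)\<^sup>2 * cinner x y"
    using complementary_operator_exists[OF A A_bound] by blast
  obtain S :: "'b \<Rightarrow> 'b" where S: "\<And>x y. cinner (B x) (B y) + cinner (S x) (S y) = (complex_of_real d)\<^sup>2 * cinner x y"
    using complementary_operator_exists[OF B B_bound] by blast
  let ?d = "\<lambda>y :: 'b. complex_of_real d *\<^sub>C y"
  have split: "(complex_of_real (c * d))\<^sup>2 * (cinner x x' * cinner y y')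
      = cinner (A x) (A x') * cinner (B y) (B y') + cinner (R x) (R x') * cinner (?d y) (?d y')
        + cinner (A x) (A x') * cinner (S y) (S y')" for x x' y y'
  proof -
    have "(complex_of_real (c * d))\<^sup>2 * (cinner x x' * cinner y y')
        = ((complex_of_real c)\<^sup>2 * cinner x x') * ((complex_of_real d)\<^sup>2 * cinner y y')"
      by (simp add: power_mult_distrib mult_ac)
    also have "\<dots> = cinner (A x) (A x') * ((complex_of_real d)\<^sup>2 * cinner y y')
        + cinner (R x) (R x') * ((complex_of_real d)\<^sup>2 * cinner y y')"
      by (simp only: R[symmetric] distrib_right)
    also have "cinner (A x) (A x') * ((complex_of_real d)\<^sup>2 * cinner y y')
        = cinner (A x) (A x') * cinner (B y) (B y') + cinner (A x) (A x') * cinner (S y) (S y')"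
      by (simp only: S[symmetric] distrib_left)
    also have "(complex_of_real d)\<^sup>2 * cinner y y' = cinner (?d y) (?d y')"
      by (simp add: cinner_scaleC_left cinner_scaleC_right power2_eq_square)
    finally show ?thesis by (simp add: add_ac)
  qed
  have "(complex_of_real (c * d))\<^sup>2 * tens_inner s s
      = (\<Sum>p\<in>#s. \<Sum>q\<in>#s. (complex_of_real (c * d))\<^sup>2
          * (cinner (fst p) (fst q) * cinner (snd p) (snd q)))"
    by (simp only: tens_inner_def sum_mset_distrib_left)
  also have "\<dots> = tens_inner (tens_map A B s) (tens_map A B s)
      + tens_inner (tens_map R ?d s) (tens_map R ?d s) + tens_inner (tens_map A S s) (tens_map A S s)"
    by (simp only: split tens_inner_tens_map sum_mset.distrib)
  finally have eq: "(complex_of_real (c * d))\<^sup>2 * tens_inner s s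
    = tens_inner (tens_map A B s) (tens_map A B s)
      + tens_inner (tens_map R ?d s) (tens_map R ?d s) + tens_inner (tens_map A S s) (tens_map A S s)" .
  have "Re (complex_of_real r * z) = r * Re z" for r z
    by simp
  then have "Re ((complex_of_real (c * d))\<^sup>2 * tens_inner s s) = (c * d)\<^sup>2 * Re (tens_inner s s)"
    by (simp only: of_real_power[symmetric])
  then show ?thesis
    using arg_cong[OF eq, of Re] tens_inner_self(1)[of "tens_map R ?d s"] tens_inner_self(1)[of "tens_map A S s"]
    by simp
qed

text \<open>
  \<^const>\<open>tens_map\<close> need not respect the congruence unless both operators are linear, so the induced map is
  defined through a chosen representative; \<open>completion_map\<close> further below does the same with a
  chosen Cauchy sequence, as an arbitrary map need not preserve Cauchy sequences.
\<close>

definition alg_tensor_map :: "('a::complex_inner \<Rightarrow> 'a) \<Rightarrow> ('b::complex_inner \<Rightarrow> 'b)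
    \<Rightarrow> ('a, 'b) alg_tensor \<Rightarrow> ('a, 'b) alg_tensor" where
  "alg_tensor_map A B t = abs_alg_tensor (tens_map A B (rep_alg_tensor t))"

lemma alg_tensor_map_abs:
  assumes "bounded_clinear A" "bounded_clinear B"
  shows "alg_tensor_map A B (abs_alg_tensor s) = abs_alg_tensor (tens_map A B s)"
proof -
  have "tens_eq (rep_alg_tensor (abs_alg_tensor s)) s"
    by (rule Quotient3_rep_abs[OF Quotient3_alg_tensor]) (rule tens_eq.refl)
  then show ?thesis
    unfolding alg_tensor_map_def alg_tensor.abs_eq_iff by (rule tens_map_cong[OF assms])
qed

lemma alg_tensor_map:
  fixes A :: "'a::chilbert_space \<Rightarrow> 'a" and B :: "'b::chilbert_space \<Rightarrow> 'b"
  assumes A: "bounded_clinear A" and A_bound: "\<And>x. norm (A x) \<le> c * norm x" and c: "0 \<le> c"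
    and B: "bounded_clinear B" and B_bound: "\<And>y. norm (B y) \<le> d * norm y" and d: "0 \<le> d"
  shows bounded_clinear_alg_tensor_map: "bounded_clinear (alg_tensor_map A B)"
    and norm_alg_tensor_map: "norm (alg_tensor_map A B t) \<le> c * d * norm t"
    and alg_tensor_map_alg_tens: "alg_tensor_map A B (alg_tens x y) = alg_tens (A x) (B y)"
proof -
  let ?F = "alg_tensor_map A B"
  note F = alg_tensor_map_abs[OF A B]
  have add: "?F (t + u) = ?F t + ?F u" for t u
    by (induction t rule: alg_tensor.abs_induct, induction u rule: alg_tensor.abs_induct)
      (simp add: plus_alg_tensor.abs_eq F tens_map_def)
  have scale: "?F (a *\<^sub>C t) = a *\<^sub>C ?F t" for a t
    by (induction t rule: alg_tensor.abs_induct)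
      (simp add: scaleC_alg_tensor.abs_eq F tens_map_scale[OF A])
  show norm: "norm (?F t) \<le> c * d * norm t" for t
  proof (induction t rule: alg_tensor.abs_induct)
    case (1 s)
    have norm_abs: "(norm (abs_alg_tensor r))\<^sup>2 = Re (tens_inner r r)" for r :: "('a \<times> 'b) multiset"
      by (simp add: power2_norm_eq_inner inner_eq_Re_cinner cinner_alg_tensor.abs_eq)
    have "(norm (?F (abs_alg_tensor s)))\<^sup>2 \<le> (c * d * norm (abs_alg_tensor s))\<^sup>2"
      using tens_inner_tens_map_le[OF A A_bound B B_bound, of s]
      by (simp add: F norm_abs power_mult_distrib)
    then show ?case
      by (rule power2_le_imp_le) (simp add: c d)
  qed
  have "bounded_linear ?F"
    by (rule bounded_linear_intro[where K = "c * d"])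
      (use add scale norm in \<open>simp_all add: scaleR_eq_scaleC mult.commute\<close>)
  then show "bounded_clinear ?F"
    using scale by (simp add: bounded_clinear_def)
  show "?F (alg_tens x y) = alg_tens (A x) (B y)"
    by (simp add: alg_tens.abs_eq F tens_map_def)
qed

definition completion_map :: "('a::complex_inner \<Rightarrow> 'b::complex_inner) \<Rightarrow> 'a completion \<Rightarrow> 'b completion" where
  "completion_map F x = abs_completion (\<lambda>n. F (rep_completion x n))"

lemma completion_map_abs:
  assumes F: "bounded_clinear F" and X: "Cauchy X"
  shows "completion_map F (abs_completion X) = abs_completion (\<lambda>n. F (X n))"
proof -
  interpret F: bounded_linear F using F by (rule bounded_clinearD)
  have "cauchy_eq (rep_completion (abs_completion X)) X"
    by (rule Quotient3_rep_abs[OF Quotient3_completion]) (simp add: X)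
  then have "cauchy_eq (\<lambda>n. F (rep_completion (abs_completion X) n)) (\<lambda>n. F (X n))"
    using F.tendsto_zero by (auto simp: cauchy_eq_def F.Cauchy F.diff[symmetric])
  then show ?thesis
    unfolding completion_map_def by (rule Quotient3_rel_abs[OF Quotient3_completion])
qed

lemma completion_map:
  fixes F :: "'a::complex_inner \<Rightarrow> 'b::complex_inner"
  assumes F: "bounded_clinear F" and bound: "\<And>x. norm (F x) \<le> c * norm x"
  shows bounded_clinear_completion_map: "bounded_clinear (completion_map F)"
    and norm_completion_map: "norm (completion_map F v) \<le> c * norm v"
    and completion_map_to_completion: "completion_map F (to_completion x) = to_completion (F x)"
proof -
  interpret F: bounded_linear F using F by (rule bounded_clinearD)
  let ?F = "completion_map F"
  note Fabs = completion_map_abs[OF F]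
  have add: "?F (t + u) = ?F t + ?F u" for t u
  proof (induction t rule: completion.abs_induct)
    case (1 X)
    then show ?case
    proof (induction u rule: completion.abs_induct)
      case (1 Y)
      then show ?case
        by (simp add: plus_completion.abs_eq Fabs F.add Cauchy_add_seq F.Cauchy)
    qed
  qed
  have scale: "?F (a *\<^sub>C t) = a *\<^sub>C ?F t" for a t
  proof (induction t rule: completion.abs_induct)
    case (1 X)
    then show ?case
      by (simp add: scaleC_completion.abs_eq Fabs bounded_clinearD(2)[OF F] Cauchy_scaleC F.Cauchy)
  qed
  show norm: "norm (?F v) \<le> c * norm v" for v
  proof (induction v rule: completion.abs_induct)
    case (1 X)
    then have X: "Cauchy X" by simp
    have lim: "(\<lambda>n. norm (Y n)) \<longlonglongrightarrow> norm (abs_completion Y)" if "Cauchy Y"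
      for Y :: "nat \<Rightarrow> 'c::complex_inner"
      using tendsto_norm[OF to_completion_tendsto[OF that]] by (simp add: norm_to_completion)
    have "norm (abs_completion (\<lambda>n. F (X n))) \<le> c * norm (abs_completion X)"
      using bound
      by (intro LIMSEQ_le[OF lim[OF F.Cauchy[OF X]] tendsto_mult_left[OF lim[OF X]]]) blast
    then show ?case by (simp add: Fabs X)
  qed
  have "bounded_linear ?F"
    by (rule bounded_linear_intro[where K = c])
      (use add scale norm in \<open>simp_all add: scaleR_eq_scaleC mult.commute\<close>)
  then show "bounded_clinear ?F"
    using scale by (simp add: bounded_clinear_def)
  show "?F (to_completion x) = to_completion (F x)"
    by (simp add: to_completion.abs_eq Fabs convergent_Cauchy convergent_const)
qed

lemma bounded_linear_tensor_ext:
  fixes S T :: "('a::chilbert_space, 'b::chilbert_space) hilbert_tensor \<Rightarrow> 'c::real_normed_vector"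
  assumes "bounded_linear S" "bounded_linear T" and eq: "\<And>x y. S (x \<otimes>\<^sub>v y) = T (x \<otimes>\<^sub>v y)"
  shows "S = T"
proof
  fix v :: "('a, 'b) hilbert_tensor"
  interpret S: bounded_linear S by fact
  interpret T: bounded_linear T by fact
  let ?B = "range (\<lambda>(x :: 'a, y :: 'b). x \<otimes>\<^sub>v y)"
  have "S v - T v = 0" if "v \<in> span ?B" for v
  proof -
    have "S v = T v"
      by (rule linear_eq_on_span[OF S.linear T.linear _ that]) (use eq in auto)
    then show ?thesis by simp
  qed
  moreover have "continuous_on (closure (span ?B)) (\<lambda>v. S v - T v)"
    by (intro continuous_intros S.continuous_on T.continuous_on)
  moreover have "v \<in> closure (span ?B)"
    by (simp only: tensor_dense UNIV_I)
  ultimately have "S v - T v = 0"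
    using continuous_constant_on_closure[of "span ?B" "\<lambda>v. S v - T v" 0 v] by blast
  then show "S v = T v" by simp
qed

lemma tensor_op:
  fixes A :: "'a::chilbert_space \<Rightarrow> 'a" and B :: "'b::chilbert_space \<Rightarrow> 'b"
  assumes A: "bounded_clinear A" and B: "bounded_clinear B"
  shows bounded_clinear_tensor_op: "bounded_clinear (A \<otimes>\<^sub>o B)"
    and tensor_op_tensor: "(A \<otimes>\<^sub>o B) (x \<otimes>\<^sub>v y) = A x \<otimes>\<^sub>v B y"
    and norm_tensor_op: "norm ((A \<otimes>\<^sub>o B) v) \<le> onorm A * onorm B * norm v"
proof -
  let ?T = "completion_map (alg_tensor_map A B)"
  note bounds = onorm[OF bounded_clinearD(1)] onorm_pos_le[OF bounded_clinearD(1)]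
  note alg = alg_tensor_map[OF A bounds[OF A] B bounds[OF B]]
  note T = completion_map[OF alg(1,2)]
  have tensor: "?T (x \<otimes>\<^sub>v y) = A x \<otimes>\<^sub>v B y" for x y
    by (simp add: tensor_def T(3) alg(3))
  have "A \<otimes>\<^sub>o B = ?T"
    unfolding tensor_op_def
    by (rule the_equality)
      (use T(1) tensor in \<open>auto intro!: bounded_linear_tensor_ext bounded_clinearD(1)\<close>)
  then show "bounded_clinear (A \<otimes>\<^sub>o B)" "(A \<otimes>\<^sub>o B) (x \<otimes>\<^sub>v y) = A x \<otimes>\<^sub>v B y"
    "norm ((A \<otimes>\<^sub>o B) v) \<le> onorm A * onorm B * norm v"
    using T tensor by simp_all
qed

lemma tensor_op_eqI:
  assumes "bounded_clinear A" "bounded_clinear B" "bounded_clinear T"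
    and "\<And>x y. T (x \<otimes>\<^sub>v y) = A x \<otimes>\<^sub>v B y"
  shows "T = A \<otimes>\<^sub>o B"
  using assms by (intro bounded_linear_tensor_ext bounded_clinearD(1)) (simp_all add: tensor_op)

lemma tensor_op_compose:
  assumes "bounded_clinear A" "bounded_clinear B" "bounded_clinear C" "bounded_clinear D"
  shows "(A \<otimes>\<^sub>o B) \<circ> (C \<otimes>\<^sub>o D) = (A \<circ> C) \<otimes>\<^sub>o (B \<circ> D)"
  using assms by (intro tensor_op_eqI) (simp_all add: bounded_clinear_compose tensor_op)

lemma adj_tensor_op:
  fixes A :: "'a::chilbert_space \<Rightarrow> 'a" and B :: "'b::chilbert_space \<Rightarrow> 'b"
  assumes A: "bounded_clinear A" and B: "bounded_clinear B"
  shows "adj (A \<otimes>\<^sub>o B) = adj A \<otimes>\<^sub>o adj B"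
proof (rule tensor_op_eqI)
  note AB = bounded_clinear_tensor_op[OF A B]
  show "bounded_clinear (adj A)" "bounded_clinear (adj B)" "bounded_clinear (adj (A \<otimes>\<^sub>o B))"
    using A B AB by (simp_all add: bounded_clinear_adj)
  fix x :: 'a and y :: 'b
  let ?u = "adj (A \<otimes>\<^sub>o B) (x \<otimes>\<^sub>v y)" and ?w = "adj A x \<otimes>\<^sub>v adj B y"
  have "cinner (a \<otimes>\<^sub>v b) ?u = cinner (a \<otimes>\<^sub>v b) ?w" for a b
    by (simp add: cinner_adj[OF AB, symmetric] tensor_op_tensor[OF A B] cinner_tensor
        cinner_adj[OF A] cinner_adj[OF B])
  then have "(\<lambda>z. inner z ?u) = (\<lambda>z. inner z ?w)"
    by (intro bounded_linear_tensor_ext bounded_linear_inner_left) (simp add: inner_eq_Re_cinner)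
  from fun_cong[OF this] show "?u = ?w"
    by (rule eq_if_inner_eq)
qed


section \<open>The numerical radius inequality\<close>

text \<open>
  A unimodular factor \<open>u\<close> turns \<open>\<bar>\<langle>T x, x\<rangle>\<bar>\<close> into the real number \<open>Re \<langle>T x, u x\<rangle>\<close> without changing the
  forms of the positive operators.
\<close>

lemma cinner_mixed_Schwarz:
  fixes T :: "'a::chilbert_space \<Rightarrow> 'a"
  assumes T: "bounded_clinear T"
    and P: "positive_op P" and PP: "\<And>x. P (P x) = adj T (T x)"
    and Q: "positive_op Q" and QQ: "\<And>x. Q (Q x) = T (adj T x)"
  shows "(cmod (cinner (T x) x))\<^sup>2 \<le> inner (P x) x * inner (Q x) x"
proof (cases "cinner (T x) x = 0")
  case True
  then show ?thesis
    using pos_symD(3)[OF positive_opD(2)[OF P], of x] pos_symD(3)[OF positive_opD(2)[OF Q], of x]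
    by simp
next
  case False
  define z u where "z = cinner (T x) x" and "u = z / complex_of_real (cmod z)"
  have z: "z \<noteq> 0" using False by (simp add: z_def)
  have u: "cnj u * z = complex_of_real (cmod z)"
    using z complex_norm_square[of z] by (simp add: u_def field_simps power2_eq_square)
  have uu: "u * cnj u = 1"
    using z complex_norm_square[of u] by (simp add: u_def norm_divide)
  have "inner (T x) (u *\<^sub>C x) = cmod z"
    using u by (simp add: inner_eq_Re_cinner cinner_scaleC_right z_def)
  moreover have "inner (Q (u *\<^sub>C x)) (u *\<^sub>C x) = inner (Q x) x"
  proof -
    have "cinner (Q (u *\<^sub>C x)) (u *\<^sub>C x) = (u * cnj u) * cinner (Q x) x"
      unfolding bounded_clinearD(2)[OF positive_opD(1)[OF Q]] cinner_scaleC_left cinner_scaleC_right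
      by (simp only: mult_ac)
    then show ?thesis by (simp only: uu inner_eq_Re_cinner mult_1)
  qed
  moreover have "(inner (T x) (u *\<^sub>C x))\<^sup>2 \<le> inner (P x) x * inner (Q (u *\<^sub>C x)) (u *\<^sub>C x)"
    by (rule mixed_Schwarz[OF bounded_clinearD(1)[OF T] inner_adj[OF T]])
      (use P Q PP QQ in \<open>simp_all add: positive_opD\<close>)
  ultimately show ?thesis by (simp add: z_def)
qed

lemma bounded_linear_Re_op:
  assumes "bounded_clinear T"
  shows "bounded_linear (Re_op T)"
  unfolding Re_op_def
  using bounded_linear_compose[OF bounded_linear_scaleC
      bounded_linear_add[OF bounded_clinearD(1)[OF assms] bounded_clinearD(1)[OF bounded_clinear_adj[OF assms]]]] .

lemma scaleC_half: "(1 / 2) *\<^sub>C x = (1 / 2 :: real) *\<^sub>R x"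
  by (simp add: scaleR_eq_scaleC)

text \<open>
  For unit vectors \<open>4 \<langle>P x, x\<rangle> \<langle>Q x, x\<rangle> \<le> \<langle>(P + Q) x, x\<rangle>\<^sup>2 \<le> \<parallel>(P + Q) x\<parallel>\<^sup>2\<close>, and
  \<open>(P + Q)\<^sup>2 = P\<^sup>2 + Q\<^sup>2 + 2 Re (P Q)\<close>.
\<close>

lemma numerical_radius_sq_le:
  fixes T :: "'a::chilbert_space \<Rightarrow> 'a"
  assumes T: "bounded_clinear T"
    and P: "positive_op P" and PP: "\<And>x. P (P x) = adj T (T x)"
    and Q: "positive_op Q" and QQ: "\<And>x. Q (Q x) = T (adj T x)"
  shows "(numerical_radius T)\<^sup>2
    \<le> 1 / 4 * onorm (\<lambda>x. P (P x) + Q (Q x)) + 1 / 2 * onorm (Re_op (P \<circ> Q))" (is "_ \<le> ?M")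
proof -
  note P_lin = positive_opD(1)[OF P] and Q_lin = positive_opD(1)[OF Q]
  note P_sym = pos_symD[OF positive_opD(2)[OF P]] and Q_sym = pos_symD[OF positive_opD(2)[OF Q]]
  have PQ: "bounded_clinear (P \<circ> Q)"
    by (rule bounded_clinear_compose[OF P_lin Q_lin])
  have N: "bounded_linear (\<lambda>x. P (P x) + Q (Q x))"
    by (intro bounded_linear_add bounded_linear_compose[OF P_sym(1) P_sym(1)]
        bounded_linear_compose[OF Q_sym(1) Q_sym(1)])
  note R = bounded_linear_Re_op[OF PQ]
  have M: "0 \<le> ?M"
    using onorm_pos_le[OF N] onorm_pos_le[OF R] by simp
  have quad: "inner (S x) x \<le> onorm S" if "bounded_linear S" "norm x = 1" for S and x :: 'a
    using norm_cauchy_schwarz[of "S x" x] onorm[OF that(1), of x] that(2) by simp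
  have "(cmod (cinner (T x) x))\<^sup>2 \<le> ?M" if x: "norm x = 1" for x
  proof -
    define p q where "p = inner (P x) x" and "q = inner (Q x) x"
    have "(cmod (cinner (T x) x))\<^sup>2 \<le> p * q"
      unfolding p_def q_def by (rule cinner_mixed_Schwarz[OF T P PP Q QQ])
    also have "\<dots> \<le> (p + q)\<^sup>2 / 4"
      using zero_le_power2[of "p - q"] by (simp add: power2_diff power2_sum)
    also have "p + q = inner (P x + Q x) x"
      by (simp add: p_def q_def inner_add)
    also have "(inner (P x + Q x) x)\<^sup>2 / 4 \<le> inner (P x + Q x) (P x + Q x) / 4"
      using Cauchy_Schwarz_ineq[of "P x + Q x" x] x by (simp add: dot_square_norm)
    also have "inner (P x + Q x) (P x + Q x)
        = inner (P (P x) + Q (Q x)) x + 2 * inner (Re_op (P \<circ> Q) x) x"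
    proof -
      have "adj (P \<circ> Q) = Q \<circ> P"
        by (simp add: adj_compose P_lin Q_lin positive_opD(4)[OF P] positive_opD(4)[OF Q])
      then have "2 * inner (Re_op (P \<circ> Q) x) x = inner (P (Q x)) x + inner (Q (P x)) x"
        by (simp add: Re_op_def scaleC_half inner_add)
      then show ?thesis
        by (simp only: inner_add P_sym(2) Q_sym(2))
    qed
    also have "\<dots> / 4 \<le> (onorm (\<lambda>x. P (P x) + Q (Q x)) + 2 * onorm (Re_op (P \<circ> Q))) / 4"
      using quad[OF N x] quad[OF R x] by simp
    finally show ?thesis by simp
  qed
  then have "cmod (cinner (T x) x) \<le> sqrt ?M" if "norm x = 1" for x
    using that by (simp add: real_le_rsqrt)
  moreover have "0 \<le> sqrt ?M" using M by simp
  ultimately have "numerical_radius T \<le> sqrt ?M"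
    unfolding numerical_radius_def by (intro cSup_least) auto
  moreover have "0 \<le> numerical_radius T"
    unfolding numerical_radius_def
    using \<open>\<And>x. norm x = 1 \<Longrightarrow> cmod (cinner (T x) x) \<le> sqrt ?M\<close> \<open>0 \<le> sqrt ?M\<close>
    by (intro cSup_upper bdd_aboveI[of _ "sqrt ?M"]) auto
  ultimately have "(numerical_radius T)\<^sup>2 \<le> (sqrt ?M)\<^sup>2"
    by (rule power_mono)
  then show ?thesis using M by simp
qed

lemma onorm_Re_op_le:
  assumes T: "bounded_clinear T" and bound: "\<And>x. norm (T x) \<le> c * norm x" and "0 \<le> c"
  shows "onorm (Re_op T) \<le> c"
proof (rule onorm_bound)
  fix x
  have "norm (T x + adj T x) \<le> c * norm x + c * norm x"
    by (intro norm_triangle_le add_mono bound norm_adj_le assms)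
  then show "norm (Re_op T x) \<le> c * norm x"
    by (simp add: Re_op_def norm_scaleC)
qed (rule \<open>0 \<le> c\<close>)

text \<open>The tensor product of the two square roots is self-adjoint with square \<open>A \<otimes> B\<close>.\<close>

lemma positive_op_tensor_op:
  assumes "positive_op A" "positive_op B"
  shows "positive_op (A \<otimes>\<^sub>o B)"
proof -
  let ?S = "sqrt_op A \<otimes>\<^sub>o sqrt_op B"
  note A = positive_op_sqrt_op[OF assms(1)] and B = positive_op_sqrt_op[OF assms(2)]
  note lin = positive_opD(1)[OF A] positive_opD(1)[OF B]
  have "adj ?S = ?S"
    by (simp add: adj_tensor_op lin positive_opD(4)[OF A] positive_opD(4)[OF B])
  moreover have "sqrt_op A \<circ> sqrt_op A = A" "sqrt_op B \<circ> sqrt_op B = B"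
    by (simp_all add: fun_eq_iff sqrt_op_square assms)
  then have "?S \<circ> ?S = A \<otimes>\<^sub>o B"
    by (simp add: tensor_op_compose lin)
  ultimately show ?thesis
    using positive_op_adj_compose[OF bounded_clinear_tensor_op[OF lin]] by simp
qed

theorem theorem2p6:
  fixes A :: "'a::chilbert_space \<Rightarrow> 'a" and B :: "'b::chilbert_space \<Rightarrow> 'b"
  assumes "bounded_clinear A" and "bounded_clinear B"
  shows
    "(numerical_radius (A \<otimes>\<^sub>o B))\<^sup>2
      \<le> 1 / 4 * onorm (\<lambda>v. ((abs_op A ^^ 2) \<otimes>\<^sub>o (abs_op B ^^ 2)) v
                       + ((abs_op (adj A) ^^ 2) \<otimes>\<^sub>o (abs_op (adj B) ^^ 2)) v)
        + 1 / 2 * onorm (Re_op ((abs_op A \<circ> abs_op (adj A)) \<otimes>\<^sub>o (abs_op B \<circ> abs_op (adj B))))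
    \<and> 1 / 4 * onorm (\<lambda>v. ((abs_op A ^^ 2) \<otimes>\<^sub>o (abs_op B ^^ 2)) v
                       + ((abs_op (adj A) ^^ 2) \<otimes>\<^sub>o (abs_op (adj B) ^^ 2)) v)
        + 1 / 2 * onorm (Re_op ((abs_op A \<circ> abs_op (adj A)) \<otimes>\<^sub>o (abs_op B \<circ> abs_op (adj B))))
      \<le> 1 / 4 * (onorm A * onorm B + sqrt (onorm (A ^^ 2)) * sqrt (onorm (B ^^ 2)))\<^sup>2
    \<and> 1 / 4 * (onorm A * onorm B + sqrt (onorm (A ^^ 2)) * sqrt (onorm (B ^^ 2)))\<^sup>2
      \<le> (onorm A)\<^sup>2 * (onorm B)\<^sup>2"
proof -
  note A = assms(1) and B = assms(2)
  note A' = bounded_clinear_adj[OF A] and B' = bounded_clinear_adj[OF B]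
  note absA = positive_op_abs_op[OF A] and absB = positive_op_abs_op[OF B]
  note absA' = positive_op_abs_op[OF A'] and absB' = positive_op_abs_op[OF B']
  note lin = A B A' B' positive_opD(1)[OF absA] positive_opD(1)[OF absB]
    positive_opD(1)[OF absA'] positive_opD(1)[OF absB']
  have pow2: "F ^^ 2 = F \<circ> F" for F :: "'c \<Rightarrow> 'c"
    by (simp add: numeral_2_eq_2)
  \<comment> \<open>\<open>P\<close> and \<open>Q\<close> are \<open>\<bar>T\<bar>\<close> and \<open>\<bar>T\<^sup>*\<bar>\<close> by uniqueness of positive square roots\<close>
  define T P Q where "T = A \<otimes>\<^sub>o B" and "P = abs_op A \<otimes>\<^sub>o abs_op B"
    and "Q = abs_op (adj A) \<otimes>\<^sub>o abs_op (adj B)"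
  have T: "bounded_clinear T"
    unfolding T_def by (rule bounded_clinear_tensor_op[OF A B])
  have P: "positive_op P" and Q: "positive_op Q"
    unfolding P_def Q_def by (rule positive_op_tensor_op absA absB absA' absB')+
  have adj_T: "adj T = adj A \<otimes>\<^sub>o adj B"
    unfolding T_def by (rule adj_tensor_op[OF A B])
  have abs_sq: "abs_op S \<circ> abs_op S = adj S \<circ> S" if "bounded_clinear S" for S :: "'c::chilbert_space \<Rightarrow> 'c"
    by (simp add: comp_def abs_op_square that)
  have PP': "(abs_op A ^^ 2) \<otimes>\<^sub>o (abs_op B ^^ 2) = P \<circ> P"
    and QQ': "(abs_op (adj A) ^^ 2) \<otimes>\<^sub>o (abs_op (adj B) ^^ 2) = Q \<circ> Q"
    and PQ': "(abs_op A \<circ> abs_op (adj A)) \<otimes>\<^sub>o (abs_op B \<circ> abs_op (adj B)) = P \<circ> Q"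
    by (simp_all add: P_def Q_def pow2 tensor_op_compose lin)
  have "P \<circ> P = adj T \<circ> T" "Q \<circ> Q = T \<circ> adj T"
    unfolding P_def Q_def adj_T unfolding T_def
    by (simp_all add: tensor_op_compose lin abs_sq adj_adj)
  then have PP: "P (P x) = adj T (T x)" and QQ: "Q (Q x) = T (adj T x)" for x
    by (metis comp_apply)+
  define N R where "N = onorm (\<lambda>v. P (P v) + Q (Q v))" and "R = onorm (Re_op (P \<circ> Q))"
  \<comment> \<open>bounds for \<open>\<parallel>T\<parallel>\<close> and \<open>\<parallel>T\<^sup>2\<parallel>\<close>\<close>
  define a b where "a = onorm A * onorm B" and "b = onorm (A \<circ> A) * onorm (B \<circ> B)"
  have AA: "bounded_clinear (A \<circ> A)" and BB: "bounded_clinear (B \<circ> B)"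
    using A B by (simp_all add: bounded_clinear_compose)
  have pos: "0 \<le> onorm S" if "bounded_clinear S" for S :: "'c::complex_inner \<Rightarrow> 'c"
    using that by (intro onorm_pos_le bounded_clinearD)
  have a: "0 \<le> a" and b: "0 \<le> b"
    unfolding a_def b_def using A B AA BB by (auto intro!: mult_nonneg_nonneg pos)
  have b_le: "b \<le> a\<^sup>2"
  proof -
    have "onorm (S \<circ> S) \<le> onorm S * onorm S" if "bounded_clinear S" for S :: "'c::complex_inner \<Rightarrow> 'c"
      using that by (intro onorm_compose bounded_clinearD)
    from mult_mono[OF this[OF A] this[OF B]] show ?thesis
      using pos[OF A] pos[OF BB] by (simp add: a_def b_def power2_eq_square mult_ac)
  qed
  have T_bound: "norm (T v) \<le> a * norm v" for v
    unfolding T_def a_def by (rule norm_tensor_op[OF A B])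
  have "T \<circ> T = (A \<circ> A) \<otimes>\<^sub>o (B \<circ> B)"
    by (simp add: T_def tensor_op_compose A B)
  then have TT_bound: "norm (T (T v)) \<le> b * norm v" for v
    unfolding b_def using norm_tensor_op[OF AA BB, of v] by (metis comp_apply)
  have N_le: "N \<le> a\<^sup>2 + b"
    unfolding N_def PP QQ
  proof (rule onorm_bound)
    show "norm (adj T (T v) + T (adj T v)) \<le> (a\<^sup>2 + b) * norm v" for v
      by (rule norm_adjoint_products_sum_le[OF inner_adj[OF T] T_bound norm_adj_le[OF T T_bound a] TT_bound a b])
  qed (use b in simp)
  have R_le: "R \<le> b"
    unfolding R_def
  proof (rule onorm_Re_op_le)
    show "bounded_clinear (P \<circ> Q)"
      by (rule bounded_clinear_compose[OF positive_opD(1)[OF P] positive_opD(1)[OF Q]])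
    have abs_le: "onorm (abs_op S \<circ> abs_op (adj S)) \<le> onorm (S \<circ> S)" if S: "bounded_clinear S"
      for S :: "'c::chilbert_space \<Rightarrow> 'c"
    proof (rule onorm_bound)
      note SS = bounded_clinear_compose[OF S S]
      show "0 \<le> onorm (S \<circ> S)" using SS by (rule pos)
      have "norm (S (S x)) \<le> onorm (S \<circ> S) * norm x" for x
        using onorm[OF bounded_clinearD(1)[OF SS], of x] by (simp only: comp_apply)
      then have "norm (abs_op S (abs_op (adj S) x)) \<le> onorm (S \<circ> S) * norm x" for x
        using pos[OF SS] by (rule norm_abs_op_abs_op_adj_le[OF S])
      then show "norm ((abs_op S \<circ> abs_op (adj S)) x) \<le> onorm (S \<circ> S) * norm x" for x
        by (simp only: comp_apply)
    qed
    show "norm ((P \<circ> Q) v) \<le> b * norm v" for v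
    proof -
      have "norm ((P \<circ> Q) v)
          \<le> onorm (abs_op A \<circ> abs_op (adj A)) * onorm (abs_op B \<circ> abs_op (adj B)) * norm v"
        unfolding PQ'[symmetric] by (rule norm_tensor_op) (simp_all only: bounded_clinear_compose lin)
      also have "\<dots> \<le> b * norm v"
        unfolding b_def
        by (intro mult_right_mono mult_mono abs_le A B pos[OF AA] norm_ge_zero pos)
          (simp only: bounded_clinear_compose lin)
      finally show ?thesis .
    qed
  qed (rule b)
  define m where "m = sqrt b"
  have m: "0 \<le> m" "m\<^sup>2 = b"
    using b by (simp_all add: m_def)
  have m_le: "m \<le> a"
    by (rule power2_le_imp_le) (simp_all add: m(2) b_le a)
  have m_eq: "sqrt (onorm (A ^^ 2)) * sqrt (onorm (B ^^ 2)) = m"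
    by (simp add: m_def b_def pow2 real_sqrt_mult)
  have first: "(numerical_radius T)\<^sup>2 \<le> 1 / 4 * N + 1 / 2 * R"
    unfolding N_def R_def by (rule numerical_radius_sq_le[OF T P PP Q QQ])
  have "1 / 4 * N + 1 / 2 * R \<le> 1 / 4 * (a\<^sup>2 + m\<^sup>2) + 1 / 2 * m\<^sup>2"
    unfolding m(2) by (intro add_mono mult_left_mono N_le R_le) simp_all
  \<comment> \<open>the difference of the two sides is \<open>m (a - m) / 2\<close>\<close>
  also have "\<dots> \<le> 1 / 4 * (a + m)\<^sup>2"
    using mult_right_mono[OF m_le m(1)] by (simp add: field_simps power2_eq_square)
  finally have second: "1 / 4 * N + 1 / 2 * R \<le> 1 / 4 * (a + m)\<^sup>2" .
  have third: "1 / 4 * (a + m)\<^sup>2 \<le> (onorm A)\<^sup>2 * (onorm B)\<^sup>2"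
    using power_mono[of "a + m" "2 * a" 2] m m_le a by (simp add: a_def power_mult_distrib)
  show ?thesis
    using first second third
    by (simp only: PP' QQ' PQ' m_eq T_def[symmetric] a_def[symmetric] N_def R_def comp_apply simp_thms)
qed

end
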